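(* Let $\{a_m\}_{m\ge0}$ be a real sequence with $a_m\to A$ as $m\to\infty$ for some constant $A$. Then the function $u$ given by the harmonic extension to each cell $\overline Y_m$, $m\ge1$, of the values $u(q_1)=a_0$, $u(x_m)=a_m$ $(m\ge1)$, $$u(y_1)=\frac15\Big(a_0+a_1+18\sum_{k=2}^\infty\frac1{3^k}a_k\Big),$$ and, for $m\ge2$, $$u(y_m)=\frac1{5^m}\Big(a_0-\frac97\sum_{k=1}^\infty\frac1{3^k}a_k+\frac27\sum_{k=1}^m5^ka_k\Big)+\frac97\sum_{k=1}^\infty\frac1{3^k}a_{m+k},$$ solves the boundary value problem $\Delta u=0$ on $\Omega$, $u(q_1)=a_0$, $u(x_m)=a_m$ $(m\ge1)$. Furthermore, this function is the unique solution in $C(\overline\Omega)$.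
   Context: Let $q_0,q_1,q_2$ be the vertices of an equilateral triangle, $F_j(x)=(x+q_j)/2$, and let $SG$ be the Sierpinski gasket, the nonempty compact set with $SG=\bigcup_{j=0}^2F_jSG$. A cell of level $m$ is $F_{w_1}\cdots F_{w_m}SG$; its boundary points are $F_{w_1}\cdots F_{w_m}q_j$, $j=0,1,2$. Half gasket: $x_m=F_0^{m-1}F_2q_1$ ($m\ge1$), $y_m=F_0^mq_1$ ($m\ge0$, so $y_0=q_1$), $\overline Y_m=F_0^{m-1}F_1SG$ ($m\ge 1$), a level-$m$ cell with boundary points $y_{m-1},y_m,x_m$. Put $X=\{x_m\}_{m\ge1}$, $\overline\Omega=\{q_0\}\cup\bigcup_{m\ge1}\overline Y_m$, $\partial\Omega=\{q_0,q_1\}\cup X$, $\Omega=\overline\Omega\setminus\partial\Omega$. A function on a cell is harmonic if it is the continuous function determined by its values at the three boundary points $v_0,v_1,v_2$ through the harmonic extension algorithm: at the level-one-finer junction point between $v_i$ and $v_j$ it takes the value $(2u(v_i)+2u(v_j)+u(v_k))/5$ ($\{i,j,k\}=\{0,1,2\}$), and this is iterated on all smaller cells. $\Delta$ is the Kigami Laplacian for the standard measure. "$\Delta u=0$ on $\Omega$" means: $u$ is harmonic on each cell $\overline Y_m$, and at each $y_m$, $m\ge1$, the normal derivatives match: $$\Big(\tfrac53\Big)^m[2u(y_m)-u(y_{m-1})-u(x_m)]+\Big(\tfrac53\Big)^{m+1}[2u(y_m)-u(y_{m+1})-u(x_{m+1})]=0 .$$ No value is prescribed at $q_0$; the function $u$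 is understood to be given its limiting value at $q_0$. *)

theory Defs
  imports "HOL-Analysis.Analysis"
begin

definition equilateral :: "(nat \<Rightarrow> real^2) \<Rightarrow> bool" where
  "equilateral q \<longleftrightarrow> q 0 \<noteq> q 1 \<and> dist (q 0) (q 1) = dist (q 1) (q 2) \<and> dist (q 1) (q 2) = dist (q 2) (q 0)"

definition sg_map :: "(nat \<Rightarrow> real^2) \<Rightarrow> nat \<Rightarrow> real^2 \<Rightarrow> real^2" where
  "sg_map q j x = (1/2) *\<^sub>R (x + q j)"

(* The composition of the maps listed in the word; the head of the word is applied last. *)
definition sg_word :: "(nat \<Rightarrow> real^2) \<Rightarrow> nat list \<Rightarrow> real^2 \<Rightarrow> real^2" where
  "sg_word q w = foldr (sg_map q) w"

definition SG :: "(nat \<Rightarrow> real^2) \<Rightarrow> (real^2) set" where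
  "SG q = (THE K. K \<noteq> {} \<and> compact K \<and> K = (\<Union>j\<in>{0,1,2}. sg_map q j ` K))"

definition cell :: "(nat \<Rightarrow> real^2) \<Rightarrow> nat list \<Rightarrow> (real^2) set" where
  "cell q w = sg_word q w ` SG q"

(* The subcells of the cell with word w are the cells with words w @ w'; the junction point between
   the boundary points numbered i and j of such a cell is the j-th boundary point of its i-th child. *)
definition harmonic_on_cell :: "(nat \<Rightarrow> real^2) \<Rightarrow> nat list \<Rightarrow> (real^2 \<Rightarrow> real) \<Rightarrow> bool" where
  "harmonic_on_cell q w u \<longleftrightarrow>
     continuous_on (cell q w) u \<and>
     (\<forall>w'\<in>lists {0,1,2}. \<forall>i j k. {i,j,k} = {0,1,2} \<longrightarrow>
        u (sg_word q (w @ w' @ [i]) (q j)) =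
          (2 * u (sg_word q (w @ w') (q i)) + 2 * u (sg_word q (w @ w') (q j))
             + u (sg_word q (w @ w') (q k))) / 5)"

definition hg_x :: "(nat \<Rightarrow> real^2) \<Rightarrow> nat \<Rightarrow> real^2" where
  "hg_x q m = sg_word q (replicate (m - 1) 0 @ [2]) (q 1)"

definition hg_y :: "(nat \<Rightarrow> real^2) \<Rightarrow> nat \<Rightarrow> real^2" where
  "hg_y q m = sg_word q (replicate m 0) (q 1)"

definition hg_Y_word :: "nat \<Rightarrow> nat list" where
  "hg_Y_word m = replicate (m - 1) 0 @ [1]"

definition hg_closure :: "(nat \<Rightarrow> real^2) \<Rightarrow> (real^2) set" where
  "hg_closure q = {q 0} \<union> (\<Union>m\<in>{1..}. cell q (hg_Y_word m))"

(* Vanishing Laplacian on the open half gasket: harmonicity on each cell, and cancellation of the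
   two normal derivatives at each junction point between consecutive cells. *)
definition hg_laplace_zero :: "(nat \<Rightarrow> real^2) \<Rightarrow> (real^2 \<Rightarrow> real) \<Rightarrow> bool" where
  "hg_laplace_zero q u \<longleftrightarrow>
     (\<forall>m\<ge>1. harmonic_on_cell q (hg_Y_word m) u) \<and>
     (\<forall>m\<ge>1. (5/3) ^ m * (2 * u (hg_y q m) - u (hg_y q (m - 1)) - u (hg_x q m))
            + (5/3) ^ (m + 1) * (2 * u (hg_y q m) - u (hg_y q (m + 1)) - u (hg_x q (m + 1))) = 0)"

definition hg_solves_bvp :: "(nat \<Rightarrow> real^2) \<Rightarrow> (nat \<Rightarrow> real) \<Rightarrow> (real^2 \<Rightarrow> real) \<Rightarrow> bool" where
  "hg_solves_bvp q a u \<longleftrightarrow>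
     hg_laplace_zero q u \<and> u (q 1) = a 0 \<and> (\<forall>m\<ge>1. u (hg_x q m) = a m)"

(* Series starting at k = 1 or k = 2 are written with shifted index.
   Lim is a definite description: that the limit at q 0 exists is not built in. *)
definition hg_explicit_extension :: "(nat \<Rightarrow> real^2) \<Rightarrow> (nat \<Rightarrow> real) \<Rightarrow> (real^2 \<Rightarrow> real) \<Rightarrow> bool" where
  "hg_explicit_extension q a u \<longleftrightarrow>
     (\<forall>m\<ge>1. harmonic_on_cell q (hg_Y_word m) u) \<and>
     u (q 1) = a 0 \<and>
     (\<forall>m\<ge>1. u (hg_x q m) = a m) \<and>
     u (hg_y q 1) = 1/5 * (a 0 + a 1 + 18 * (\<Sum>k. 1 / 3 ^ (k + 2) * a (k + 2))) \<and>
     (\<forall>m\<ge>2. u (hg_y q m) =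
        1 / 5 ^ m * (a 0 - 9/7 * (\<Sum>k. 1 / 3 ^ (k + 1) * a (k + 1)) + 2/7 * (\<Sum>k=1..m. 5 ^ k * a k))
        + 9/7 * (\<Sum>k. 1 / 3 ^ (k + 1) * a (m + (k + 1)))) \<and>
     u (q 0) = Lim (at (q 0) within hg_closure q) u"

end

theory Submission
  imports Defs
begin

text \<open>
  The Laplace equation couples the cells of the half gasket only at the nodes \<open>y\<^sub>m\<close>. Written in the
  values \<open>u(y\<^sub>m)\<close>, the cancellation of normal derivatives is the three-term recurrence
  \<open>16 u(y\<^sub>m) = 3 u(y\<^sub>m\<^sub>-\<^sub>1) + 5 u(y\<^sub>m\<^sub>+\<^sub>1) + 3 a\<^sub>m + 5 a\<^sub>m\<^sub>+\<^sub>1\<close>, whose homogeneous solutions are spanned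
  by \<open>3\<^sup>m\<close> and \<open>5\<^sup>-\<^sup>m\<close>. The explicit formula is the solution that starts at \<open>a\<^sub>0\<close> and has no growing
  component: the averages of the past data are weighted by powers of \<open>1/5\<close>, those of the future data
  by powers of \<open>1/3\<close> (\<open>node_value_recurrence\<close>). Both averages inherit the limit of the data, with
  total weight 1, so that the node values tend to \<open>A\<close> (\<open>node_value_tendsto\<close>). As the cells shrink to
  \<open>q\<^sub>0\<close>, the maximum principle on each cell turns this into \<open>u(x) \<rightarrow> A\<close> for \<open>x \<rightarrow> q\<^sub>0\<close>
  (\<open>harmonic_tendsto_at_vertex\<close>), which is continuity at the only critical point.

  Uniqueness is the same dichotomy. The node values of the difference of two continuous solutions
  solve the homogeneous recurrence, start at 0 and converge, because \<open>y\<^sub>m \<rightarrow> q\<^sub>0\<close>. The component along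
  \<open>3\<^sup>m\<close> must vanish, and with the initial value 0 nothing is left
  (\<open>bounded_growing_recurrence_eq_0\<close>). A harmonic function on a cell is determined by its three
  vertex values (\<open>harmonic_on_cell_unique\<close>), so the two solutions agree everywhere.

  For the existence of a solution one needs harmonic functions on cells with prescribed vertex values.
  The harmonic extension algorithm assigns three values to every subcell. Their range shrinks by the
  factor \<open>3/5\<close> with each level, and the ranges of any two subcells with a common point overlap
  (\<open>cell_values_overlap\<close>). Hence the ranges of all subcells that contain a point have exactly one
  common number, the value of the extension at that point. The overlap uses that distinct
  subcells of level one meet in a single point (\<open>level1_intersection\<close>). That fact, like the
  separation of the cells \<open>Y\<^sub>m\<close> (\<open>hg_cells_intersection\<close>), is read off from barycentric coordinates,
  on which the maps \<open>F\<^sub>j\<close> act by \<open>\<lambda>\<^sub>i \<mapsto> (\<lambda>\<^sub>i + \<delta>\<^sub>i\<^sub>j)/2\<close>.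
\<close>

section \<open>The Sierpinski gasket and barycentric coordinates\<close>

lemma sg_word_Nil [simp]: "sg_word q [] x = x"
  by (simp add: sg_word_def)

lemma sg_word_Cons [simp]: "sg_word q (i # w) x = sg_map q i (sg_word q w x)"
  by (simp add: sg_word_def)

lemma sg_word_append: "sg_word q (v @ w) x = sg_word q v (sg_word q w x)"
  by (induction v) simp_all

lemma sg_map_fixed [simp]: "sg_map q i (q i) = q i"
  by (simp add: sg_map_def scaleR_add_right scaleR_half_double)

lemma sg_map_commute: "sg_map q i (q j) = sg_map q j (q i)"
  by (simp add: sg_map_def add.commute)

lemma sg_word_replicate_fixed [simp]: "sg_word q (replicate n i) (q i) = q i"
  by (induction n) simp_all

lemma dist_sg_map: "dist (sg_map q i x) (sg_map q i y) = dist x y / 2"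
  by (simp add: sg_map_def dist_norm flip: scaleR_diff_right)

lemma dist_sg_word: "dist (sg_word q w x) (sg_word q w y) = dist x y / 2 ^ length w"
  by (induction w) (simp_all add: dist_sg_map field_simps)

lemma sg_word_eq_iff [simp]: "sg_word q w x = sg_word q w y \<longleftrightarrow> x = y"
  using dist_sg_word[of q w x y] by (cases "x = y") auto

lemma sg_map_eq_iff [simp]: "sg_map q i x = sg_map q i y \<longleftrightarrow> x = y"
  using sg_word_eq_iff[of q "[i]" x y] by simp

lemma continuous_on_sg_map: "continuous_on S (sg_map q i)"
  unfolding sg_map_def[abs_def] by (intro continuous_intros)

lemma continuous_on_sg_word: "continuous_on S (sg_word q w)"
proof (induction w)
  case (Cons i w)
  then show ?case using continuous_on_compose2[OF continuous_on_sg_map[of UNIV] Cons] by simp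
qed simp

lemma closure_sg_map: "sg_map q i ` closure S = closure (sg_map q i ` S)"
proof -
  have "sg_map q i ` T = (+) ((1/2) *\<^sub>R q i) ` ((*\<^sub>R) (1/2) ` T)" for T
    by (simp add: image_image sg_map_def scaleR_add_right add.commute)
  then show ?thesis by (simp add: closure_scaleR closure_translation)
qed

lemma closure_sg_word: "sg_word q w ` closure S = closure (sg_word q w ` S)"
proof (induction w)
  case (Cons i w)
  have "sg_word q (i # w) ` T = sg_map q i ` (sg_word q w ` T)" for T
    by (simp add: image_image)
  then show ?case using Cons by (simp add: closure_sg_map)
qed simp

text \<open>
  The orbit is a countable dense part of the gasket. It starts at a fixed point of one of the maps,
  so that the empty word contributes nothing new and the orbit is already exactly self-similar; its
  closure is then the attractor.
\<close>
definition sg_orbit :: "(nat \<Rightarrow> real^2) \<Rightarrow> (real^2) set" where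
  "sg_orbit q = (\<lambda>w. sg_word q w (q 0)) ` lists {0,1,2}"

lemma sg_orbit_self_similar: "sg_orbit q = (\<Union>j\<in>{0,1,2}. sg_map q j ` sg_orbit q)"
proof
  show "(\<Union>j\<in>{0,1,2}. sg_map q j ` sg_orbit q) \<subseteq> sg_orbit q"
  proof
    fix x assume "x \<in> (\<Union>j\<in>{0,1,2}. sg_map q j ` sg_orbit q)"
    then obtain j w where "j \<in> {0,1,2}" "w \<in> lists {0,1,2}" "x = sg_word q (j # w) (q 0)"
      by (auto simp: sg_orbit_def)
    then show "x \<in> sg_orbit q"
      unfolding sg_orbit_def by (intro image_eqI[of _ _ "j # w"]) auto
  qed
  show "sg_orbit q \<subseteq> (\<Union>j\<in>{0,1,2}. sg_map q j ` sg_orbit q)"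
  proof
    fix x assume "x \<in> sg_orbit q"
    then obtain w where w: "w \<in> lists {0,1,2}" and x: "x = sg_word q w (q 0)"
      by (auto simp: sg_orbit_def)
    have "\<exists>j w'. j \<in> {0,1,2} \<and> w' \<in> lists {0,1,2} \<and> x = sg_map q j (sg_word q w' (q 0))"
    proof (cases w)
      case Nil
      then have "x = sg_map q 0 (sg_word q [] (q 0))" using x by simp
      then show ?thesis by blast
    next
      case (Cons j w')
      then show ?thesis using w x by auto
    qed
    then show "x \<in> (\<Union>j\<in>{0,1,2}. sg_map q j ` sg_orbit q)"
      unfolding sg_orbit_def by blast
  qed
qed

lemma bounded_sg_orbit: "bounded (sg_orbit q)"
proof -
  define R where "R = max (norm (q 0)) (max (norm (q 1)) (norm (q 2)))"
  have "norm (sg_word q w (q 0)) \<le> R" if "w \<in> lists {0,1,2}" for w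
    using that
  proof (induction w)
    case (Cons j w)
    have "norm (q j) \<le> R" using Cons.hyps by (auto simp: R_def)
    moreover have "norm (sg_word q w (q 0) + q j) \<le> norm (sg_word q w (q 0)) + norm (q j)"
      by (rule norm_triangle_ineq)
    ultimately show ?case using Cons.IH by (simp add: sg_map_def)
  qed (simp add: R_def)
  then show ?thesis unfolding bounded_iff sg_orbit_def by blast
qed

text \<open>
  A point of \<open>K\<close> at maximal distance from \<open>L\<close> is the image of another point of \<open>K\<close> under a map that
  halves distances and leaves \<open>L\<close> invariant, so the maximal distance is at most half of itself. Used in
  both directions, this gives the uniqueness of the attractor.
\<close>
lemma self_similar_subset:
  assumes K: "K \<noteq> {}" "compact K" "K = (\<Union>j\<in>{0,1,2}. sg_map q j ` K)"
    and L: "L \<noteq> {}" "compact L" "L = (\<Union>j\<in>{0,1,2}. sg_map q j ` L)"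
  shows "K \<subseteq> L"
proof -
  have "continuous_on K (\<lambda>x. infdist x L)" by (intro continuous_intros)
  then obtain x where x: "x \<in> K" and max: "\<And>y. y \<in> K \<Longrightarrow> infdist y L \<le> infdist x L"
    using continuous_attains_sup[OF K(2,1)] by blast
  from x K(3) obtain j z where j: "j \<in> {0,1,2}" and z: "z \<in> K" and xz: "x = sg_map q j z"
    by blast
  obtain l where l: "l \<in> L" "infdist z L = dist z l"
    using infdist_attains_inf[OF compact_imp_closed[OF L(2)] L(1)] by blast
  have "sg_map q j l \<in> L" using L(3) j l(1) by blast
  then have "infdist x L \<le> dist (sg_map q j z) (sg_map q j l)"
    unfolding xz by (rule infdist_le)
  also have "\<dots> = infdist z L / 2" using l by (simp add: dist_sg_map)
  also have "\<dots> \<le> infdist x L / 2" using max[OF z] by simp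
  finally have "infdist x L \<le> 0" by simp
  then have "infdist y L = 0" if "y \<in> K" for y
    using max[OF that] infdist_nonneg[of y L] by linarith
  then show ?thesis
    using in_closed_iff_infdist_zero[OF compact_imp_closed[OF L(2)] L(1)] by blast
qed

lemma SG_eq_closure_orbit: "SG q = closure (sg_orbit q)"
  unfolding SG_def
proof (rule the_equality)
  let ?K = "closure (sg_orbit q)"
  have "q 0 \<in> sg_orbit q" unfolding sg_orbit_def by (force intro: image_eqI[of _ _ "[]"])
  then have ne: "?K \<noteq> {}" by auto
  have comp: "compact ?K" using bounded_sg_orbit by (simp add: compact_eq_bounded_closed bounded_closure)
  have "?K = closure (\<Union>j\<in>{0,1,2}. sg_map q j ` sg_orbit q)"
    by (rule arg_cong[OF sg_orbit_self_similar])
  also have "\<dots> = (\<Union>j\<in>{0,1,2}. sg_map q j ` ?K)"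
    by (simp add: closure_sg_map)
  finally have ss: "?K = (\<Union>j\<in>{0,1,2}. sg_map q j ` ?K)" .
  show "?K \<noteq> {} \<and> compact ?K \<and> ?K = (\<Union>j\<in>{0,1,2}. sg_map q j ` ?K)"
    using ne comp ss by blast
  show "K = ?K" if "K \<noteq> {} \<and> compact K \<and> K = (\<Union>j\<in>{0,1,2}. sg_map q j ` K)" for K
    using self_similar_subset[of K q ?K] self_similar_subset[of ?K q K] that ne comp ss by blast
qed

lemma compact_SG: "compact (SG q)"
  unfolding SG_eq_closure_orbit using bounded_sg_orbit
  by (simp add: compact_eq_bounded_closed bounded_closure)

lemma SG_self_similar: "SG q = (\<Union>j\<in>{0,1,2}. sg_map q j ` SG q)"
proof -
  have "SG q = closure (\<Union>j\<in>{0,1,2}. sg_map q j ` sg_orbit q)"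
    unfolding SG_eq_closure_orbit by (rule arg_cong[OF sg_orbit_self_similar])
  also have "\<dots> = (\<Union>j\<in>{0,1,2}. sg_map q j ` SG q)"
    by (simp add: SG_eq_closure_orbit closure_sg_map)
  finally show ?thesis .
qed

lemma sg_map_in_SG: "x \<in> SG q \<Longrightarrow> j \<in> {0,1,2} \<Longrightarrow> sg_map q j x \<in> SG q"
  by (subst SG_self_similar) blast

lemma sg_word_in_SG: "x \<in> SG q \<Longrightarrow> w \<in> lists {0,1,2} \<Longrightarrow> sg_word q w x \<in> SG q"
proof (induction w)
  case (Cons i w) then show ?case using sg_map_in_SG[of _ q i] by simp
qed simp

text \<open>
  Iterating \<open>F\<^sub>j\<close> on an arbitrary point of the gasket converges to the fixed point \<open>q\<^sub>j\<close>.
\<close>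
lemma vertex_in_SG:
  assumes "j \<in> {0,1,2}"
  shows "q j \<in> SG q"
proof -
  have "SG q \<noteq> {}" unfolding SG_eq_closure_orbit sg_orbit_def by auto
  then obtain x where x: "x \<in> SG q" by blast
  have "(\<lambda>n. dist (sg_word q (replicate n j) x) (q j)) \<longlonglongrightarrow> 0"
  proof -
    have "dist (sg_word q (replicate n j) x) (q j) = dist x (q j) * (1/2) ^ n" for n
      using dist_sg_word[of q "replicate n j" x "q j"] by (simp add: power_one_over)
    then show ?thesis by (simp add: tendsto_mult_right_zero LIMSEQ_power_zero)
  qed
  then have "(\<lambda>n. sg_word q (replicate n j) x) \<longlonglongrightarrow> q j"
    by (rule Lim_transform_eventually[OF iffD2[OF tendsto_dist_iff]]) simp
  moreover have "\<And>n. sg_word q (replicate n j) x \<in> SG q"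
    using assms by (intro sg_word_in_SG x) (auto simp: in_lists_conv_set)
  ultimately show ?thesis
    by (rule closed_sequentially[OF compact_imp_closed[OF compact_SG], rotated])
qed

lemma cell_Nil [simp]: "cell q [] = SG q"
  by (simp add: cell_def)

lemma cell_Cons: "cell q (i # w) = sg_map q i ` cell q w"
  by (simp add: cell_def image_image)

lemma cell_subset_SG: "w \<in> lists {0,1,2} \<Longrightarrow> cell q w \<subseteq> SG q"
  unfolding cell_def using sg_word_in_SG by blast

lemma compact_cell: "compact (cell q w)"
  unfolding cell_def by (intro compact_continuous_image continuous_on_sg_word compact_SG)

lemma cell_cover:
  assumes "x \<in> SG q"
  obtains w where "w \<in> lists {0,1,2}" "length w = n" "x \<in> cell q w"
proof -
  have "\<exists>w \<in> lists {0,1,2}. length w = n \<and> x \<in> cell q w"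
    using assms
  proof (induction n arbitrary: x)
    case 0 then show ?case by (intro bexI[of _ "[]"]) auto
  next
    case (Suc n)
    from Suc.prems SG_self_similar[of q] obtain j z
      where j: "j \<in> {0,1,2}" and z: "z \<in> SG q" "x = sg_map q j z" by blast
    from Suc.IH[OF z(1)] obtain w where "w \<in> lists {0,1,2}" "length w = n" "z \<in> cell q w"
      by blast
    then show ?case using j z by (intro bexI[of _ "j # w"]) (auto simp: cell_Cons)
  qed
  then show ?thesis using that by blast
qed

text \<open>
  The images of the orbit are dense in a cell. Statements about all values of a continuous function thus
  reduce to the points that the harmonic extension algorithm reaches.
\<close>
lemma cell_subset_of_closed:
  assumes "continuous_on (cell q w) u" "closed T"
    and "\<And>w'. w' \<in> lists {0,1,2} \<Longrightarrow> u (sg_word q (w @ w') (q 0)) \<in> T"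
  shows "x \<in> cell q w \<Longrightarrow> u x \<in> T"
proof -
  have cl: "cell q w = closure (sg_word q w ` sg_orbit q)"
    by (simp add: cell_def SG_eq_closure_orbit closure_sg_word)
  have "u ` (sg_word q w ` sg_orbit q) \<subseteq> T"
    using assms(3) by (auto simp: sg_orbit_def sg_word_append)
  from image_closure_subset[OF assms(1)[unfolded cl] assms(2) this]
  show "x \<in> cell q w \<Longrightarrow> u x \<in> T" unfolding cl by blast
qed

text \<open>
  The Gram matrix of the three vectors from the centroid to the vertices. All distances being equal, it
  depends only on the side length.
\<close>
lemma equilateral_centroid_inner:
  fixes a b c :: "'a::real_inner"
  assumes "dist b c = dist a b" "dist c a = dist a b"
  defines "g \<equiv> (1/3) *\<^sub>R (a + b + c)"
  shows "(a - g) \<bullet> (a - g) = (dist a b)\<^sup>2 / 3" "(b - g) \<bullet> (b - g) = (dist a b)\<^sup>2 / 3"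
    "(c - g) \<bullet> (c - g) = (dist a b)\<^sup>2 / 3"
    "(a - g) \<bullet> (b - g) = - (dist a b)\<^sup>2 / 6" "(b - g) \<bullet> (a - g) = - (dist a b)\<^sup>2 / 6"
    "(b - g) \<bullet> (c - g) = - (dist a b)\<^sup>2 / 6" "(c - g) \<bullet> (b - g) = - (dist a b)\<^sup>2 / 6"
    "(c - g) \<bullet> (a - g) = - (dist a b)\<^sup>2 / 6" "(a - g) \<bullet> (c - g) = - (dist a b)\<^sup>2 / 6"
proof -
  define L where "L = (dist a b)\<^sup>2"
  have side: "(dist x y)\<^sup>2 = x \<bullet> x + y \<bullet> y - 2 * (x \<bullet> y)" for x y :: 'a
    by (simp add: dist_norm power2_norm_eq_inner inner_diff_left inner_diff_right inner_commute)
  have ab: "a \<bullet> b = (a \<bullet> a + b \<bullet> b - L) / 2" using side[of a b] by (simp add: L_def)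
  have bc: "b \<bullet> c = (b \<bullet> b + c \<bullet> c - L) / 2" using side[of b c] by (simp add: L_def assms)
  have ca: "c \<bullet> a = (c \<bullet> c + a \<bullet> a - L) / 2" using side[of c a] by (simp add: L_def assms)
  note expand = g_def inner_diff_left inner_diff_right inner_add_left inner_add_right
    inner_scaleR_left inner_scaleR_right inner_commute[of b a] inner_commute[of c b]
    inner_commute[of a c] ab bc ca
  show "(a - g) \<bullet> (a - g) = (dist a b)\<^sup>2 / 3" "(b - g) \<bullet> (b - g) = (dist a b)\<^sup>2 / 3"
    "(c - g) \<bullet> (c - g) = (dist a b)\<^sup>2 / 3"
    "(a - g) \<bullet> (b - g) = - (dist a b)\<^sup>2 / 6" "(b - g) \<bullet> (a - g) = - (dist a b)\<^sup>2 / 6"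
    "(b - g) \<bullet> (c - g) = - (dist a b)\<^sup>2 / 6" "(c - g) \<bullet> (b - g) = - (dist a b)\<^sup>2 / 6"
    "(c - g) \<bullet> (a - g) = - (dist a b)\<^sup>2 / 6" "(a - g) \<bullet> (c - g) = - (dist a b)\<^sup>2 / 6"
    unfolding L_def[symmetric] by (simp_all add: expand field_simps)
qed

locale equilateral_triangle =
  fixes q :: "nat \<Rightarrow> real^2"
  assumes equilateral: "equilateral q"
begin

text \<open>
  For an equilateral triangle the barycentric coordinate of a vertex is an inner product with the
  vector from the centroid to that vertex; \<open>1/3\<close> is the value at the centroid, and the factor normalizes the
  value at the vertex to 1.
\<close>
definition bary :: "nat \<Rightarrow> real^2 \<Rightarrow> real" where
  "bary i x = 1/3 + 2 / (dist (q 0) (q 1))\<^sup>2 *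
     ((x - (1/3) *\<^sub>R (q 0 + q 1 + q 2)) \<bullet> (q i - (1/3) *\<^sub>R (q 0 + q 1 + q 2)))"

lemma bary_vertex:
  assumes "i \<in> {0,1,2}" "j \<in> {0,1,2}"
  shows "bary i (q j) = (if i = j then 1 else 0)"
proof -
  define L where "L = (dist (q 0) (q 1))\<^sup>2"
  have "q 0 \<noteq> q 1" using equilateral unfolding equilateral_def by blast
  then have L: "L > 0" by (simp add: L_def)
  have sides: "dist (q 1) (q 2) = dist (q 0) (q 1)" "dist (q 2) (q 0) = dist (q 0) (q 1)"
    using equilateral by (auto simp: equilateral_def)
  have "(q j - (1/3) *\<^sub>R (q 0 + q 1 + q 2)) \<bullet> (q i - (1/3) *\<^sub>R (q 0 + q 1 + q 2))
    = (if i = j then L / 3 else - L / 6)"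
    using assms equilateral_centroid_inner[OF sides] by (auto simp: L_def)
  then show ?thesis using L unfolding bary_def L_def[symmetric] by simp
qed

lemma bary_sg_map:
  assumes "i \<in> {0,1,2}" "j \<in> {0,1,2}"
  shows "bary i (sg_map q j x) = (bary i x + (if i = j then 1 else 0)) / 2"
proof -
  have "bary i (sg_map q j x) = (bary i x + bary i (q j)) / 2"
    by (simp add: bary_def sg_map_def inner_diff_left inner_add_left algebra_simps add_divide_distrib)
  then show ?thesis using bary_vertex[OF assms] by simp
qed

lemma continuous_on_bary: "continuous_on S (bary i)"
  unfolding bary_def[abs_def] by (intro continuous_intros)

text \<open>
  All three properties are closed conditions that hold at \<open>q\<^sub>0\<close> and are preserved by the maps
  \<open>F\<^sub>j\<close>. Hence they hold on the orbit and on its closure.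
\<close>
lemma SG_barycentric:
  assumes "x \<in> SG q"
  shows bary_nonneg: "\<And>i. i \<in> {0,1,2} \<Longrightarrow> bary i x \<ge> 0"
    and bary_sum: "bary 0 x + bary 1 x + bary 2 x = 1"
    and bary_repr: "x = bary 0 x *\<^sub>R q 0 + bary 1 x *\<^sub>R q 1 + bary 2 x *\<^sub>R q 2"
proof -
  let ?B = "{x. 0 \<le> bary 0 x} \<inter> {x. 0 \<le> bary 1 x} \<inter> {x. 0 \<le> bary 2 x}
    \<inter> {x. bary 0 x + bary 1 x + bary 2 x = 1}
    \<inter> {x. x = bary 0 x *\<^sub>R q 0 + bary 1 x *\<^sub>R q 1 + bary 2 x *\<^sub>R q 2}"
  have "closed ?B"
    by (intro closed_Int closed_Collect_le closed_Collect_eq continuous_intros continuous_on_bary)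
  moreover have "sg_orbit q \<subseteq> ?B"
  proof -
    have "sg_word q w (q 0) \<in> ?B" if "w \<in> lists {0,1,2}" for w
      using that
    proof (induction w)
      case Nil then show ?case by (simp add: bary_vertex)
    next
      case (Cons j w)
      define y where "y = sg_word q w (q 0)"
      have y: "y \<in> ?B" using Cons.IH by (simp add: y_def)
      have j: "j = 0 \<or> j = 1 \<or> j = 2" using Cons.hyps(1) by auto
      have "sg_map q j y =
        (1/2) *\<^sub>R (bary 0 y *\<^sub>R q 0 + bary 1 y *\<^sub>R q 1 + bary 2 y *\<^sub>R q 2 + q j)"
        using y by (simp add: sg_map_def)
      also have "\<dots> = bary 0 (sg_map q j y) *\<^sub>R q 0 + bary 1 (sg_map q j y) *\<^sub>R q 1
          + bary 2 (sg_map q j y) *\<^sub>R q 2"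
        using j by (elim disjE) (simp_all add: bary_sg_map add_divide_distrib algebra_simps)
      finally have "sg_map q j y = bary 0 (sg_map q j y) *\<^sub>R q 0
          + bary 1 (sg_map q j y) *\<^sub>R q 1 + bary 2 (sg_map q j y) *\<^sub>R q 2" .
      moreover have "bary 0 (sg_map q j y) + bary 1 (sg_map q j y) + bary 2 (sg_map q j y) = 1"
        using y j by (elim disjE) (simp_all add: bary_sg_map add_divide_distrib[symmetric])
      moreover have "0 \<le> bary i (sg_map q j y)" if "i \<in> {0,1,2}" for i
        using y Cons.hyps(1) that by (auto simp: bary_sg_map)
      ultimately have "sg_map q j y \<in> ?B" by blast
      then show ?case by (simp add: y_def)
    qed
    then show ?thesis unfolding sg_orbit_def by (rule image_subsetI)
  qed
  ultimately have "SG q \<subseteq> ?B" unfolding SG_eq_closure_orbit by (intro closure_minimal)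
  with assms have "x \<in> ?B" by (rule subsetD[rotated])
  then have B: "0 \<le> bary 0 x" "0 \<le> bary 1 x" "0 \<le> bary 2 x"
    "bary 0 x + bary 1 x + bary 2 x = 1"
    "x = bary 0 x *\<^sub>R q 0 + bary 1 x *\<^sub>R q 1 + bary 2 x *\<^sub>R q 2"
    by (simp_all only: Int_iff mem_Collect_eq)
  show "bary i x \<ge> 0" if "i \<in> {0,1,2}" for i
    using that B(1-3) by auto
  show "bary 0 x + bary 1 x + bary 2 x = 1" by (rule B)
  show "x = bary 0 x *\<^sub>R q 0 + bary 1 x *\<^sub>R q 1 + bary 2 x *\<^sub>R q 2" by (rule B)
qed

lemma bary_le_1:
  assumes "x \<in> SG q" "i \<in> {0,1,2}"
  shows "bary i x \<le> 1"
  using bary_sum[OF assms(1)] bary_nonneg[OF assms(1), of 0] bary_nonneg[OF assms(1), of 1]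
    bary_nonneg[OF assms(1), of 2] assms(2) by auto

lemma bary_eq_1_imp_vertex:
  assumes "x \<in> SG q" "j \<in> {0,1,2}" "bary j x = 1"
  shows "x = q j"
proof -
  have "bary i x = (if i = j then 1 else 0)" if "i \<in> {0,1,2}" for i
    using bary_sum[OF assms(1)] bary_nonneg[OF assms(1), of 0] bary_nonneg[OF assms(1), of 1]
      bary_nonneg[OF assms(1), of 2] assms(2,3) that by auto
  then have b: "bary 0 x = (if 0 = j then 1 else 0)" "bary 1 x = (if 1 = j then 1 else 0)"
    "bary 2 x = (if 2 = j then 1 else 0)" by blast+
  show ?thesis
    using assms(2) bary_repr[OF assms(1), unfolded b] by auto
qed

lemma sg_map_eq_vertex:
  assumes "x \<in> SG q" "i \<in> {0,1,2}" "j \<in> {0,1,2}" "sg_map q i x = q j"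
  shows "i = j \<and> x = q j"
proof -
  have "(bary j x + (if j = i then 1 else 0)) / 2 = 1"
    using bary_sg_map[OF assms(3,2), of x] bary_vertex[OF assms(3,3)] assms(4) by simp
  then show ?thesis
    using bary_le_1[OF assms(1,3)] bary_eq_1_imp_vertex[OF assms(1,3)] by (auto split: if_splits)
qed

text \<open>
  A common point \<open>z\<close> of the two cells has both coordinates \<open>\<lambda>\<^sub>i\<close> and \<open>\<lambda>\<^sub>j\<close> at least \<open>1/2\<close>. Comparing the two
  expressions for each of them forces the preimages to be vertices.
\<close>
lemma level1_intersection:
  assumes x: "x \<in> SG q" and y: "y \<in> SG q" and ij: "i \<in> {0,1,2}" "j \<in> {0,1,2}" "i \<noteq> j"
    and eq: "sg_map q i x = sg_map q j y"
  shows "x = q j \<and> y = q i"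
proof -
  define z where "z = sg_map q i x"
  have z: "z \<in> SG q" unfolding z_def by (intro sg_map_in_SG x ij)
  have i: "bary i z = (bary i x + 1) / 2" "bary i z = bary i y / 2"
    using ij bary_sg_map[of i i x] bary_sg_map[of i j y] eq by (auto simp: z_def)
  have j: "bary j z = (bary j y + 1) / 2"
    using ij bary_sg_map[of j j y] eq by (auto simp: z_def)
  have "bary j z = bary j x / 2"
    using ij bary_sg_map[of j i x] by (auto simp: z_def)
  then have "bary j x = bary j y + 1" "bary i y = bary i x + 1" using i j by simp_all
  then have "bary j x \<ge> 1" "bary i y \<ge> 1"
    using bary_nonneg[OF y ij(2)] bary_nonneg[OF x ij(1)] by simp_all
  then have "bary j x = 1" "bary i y = 1"
    using bary_le_1[OF x ij(2)] bary_le_1[OF y ij(1)] by simp_all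
  then show ?thesis using bary_eq_1_imp_vertex x y ij by blast
qed

end

section \<open>Harmonic functions on a cell\<close>

text \<open>
  One step of the harmonic extension algorithm: the values at the vertices of the \<open>i\<close>-th child. The
  usual weights \<open>2, 2, 1\<close> are rewritten with the sum of all three values, so that the third index
  does not have to be named (see \<open>child_values_eq\<close>).
\<close>
definition child_values :: "nat \<Rightarrow> (nat \<Rightarrow> real) \<Rightarrow> nat \<Rightarrow> real" where
  "child_values i v j = (if i = j then v j else (v i + v j + (v 0 + v 1 + v 2)) / 5)"

definition cell_values :: "(nat \<Rightarrow> real) \<Rightarrow> nat list \<Rightarrow> nat \<Rightarrow> real" where
  "cell_values v w = foldl (\<lambda>v i. child_values i v) v w"

lemma cell_values_Nil [simp]: "cell_values v [] = v"
  by (simp add: cell_values_def)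

lemma cell_values_Cons [simp]: "cell_values v (i # w) = cell_values (child_values i v) w"
  by (simp add: cell_values_def)

lemma cell_values_append: "cell_values v (w @ w') = cell_values (cell_values v w) w'"
  by (simp add: cell_values_def)

lemma child_values_commute: "child_values i v j = child_values j v i"
  by (simp add: child_values_def)

lemma child_values_fixed [simp]: "child_values i v i = v i"
  by (simp add: child_values_def)

lemma cell_values_replicate_fixed: "cell_values v (replicate n i) i = v i"
  by (induction n arbitrary: v) simp_all

lemma child_values_eq:
  assumes "{i, j, k} = {0, 1, 2::nat}"
  shows "child_values i v j = (2 * v i + 2 * v j + v k) / 5"
proof -
  have "card {i, j, k} = 3" using assms by simp
  then have d: "i \<noteq> j" "i \<noteq> k" "j \<noteq> k"
    by (auto simp: card_insert_if split: if_splits)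
  have "sum v {i, j, k} = sum v {0, 1, 2}" using assms by simp
  then have "v i + v j + v k = v 0 + v 1 + v 2" using d by (simp add: add.assoc)
  then show ?thesis using d by (simp add: child_values_def)
qed

definition low :: "(nat \<Rightarrow> real) \<Rightarrow> real" where
  "low v = min (v 0) (min (v 1) (v 2))"

definition high :: "(nat \<Rightarrow> real) \<Rightarrow> real" where
  "high v = max (v 0) (max (v 1) (v 2))"

lemma low_le: "j \<in> {0,1,2} \<Longrightarrow> low v \<le> v j"
  and le_high: "j \<in> {0,1,2} \<Longrightarrow> v j \<le> high v"
  by (auto simp: low_def high_def)

lemma low_attained: obtains j where "j \<in> {0,1,2}" "low v = v j"
  by (cases "v 0 \<le> v 1"; cases "v 1 \<le> v 2"; cases "v 0 \<le> v 2") (auto simp: low_def min_def)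

lemma high_attained: obtains j where "j \<in> {0,1,2}" "high v = v j"
  by (cases "v 0 \<le> v 1"; cases "v 1 \<le> v 2"; cases "v 0 \<le> v 2") (auto simp: high_def max_def)

lemma third_index:
  assumes "i \<in> {0,1,2::nat}" "j \<in> {0,1,2}" "i \<noteq> j"
  obtains k where "{i, j, k} = {0, 1, 2}" "k \<in> {0,1,2}"
proof -
  have "{i, j, 3 - i - j} = {0, 1, 2} \<and> 3 - i - j \<in> {0,1,2}"
    using assms by auto
  then show ?thesis using that[of "3 - i - j"] by simp
qed

text \<open>
  Every value of the \<open>i\<close>-th child, the one at the shared vertex included, is a convex combination that
  gives weight at least \<open>2/5\<close> to \<open>v i\<close>. This common part cancels in differences and leaves the
  contraction factor \<open>3/5\<close>.
\<close>
lemma child_values_bounds: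
  assumes i: "i \<in> {0,1,2}" and j: "j \<in> {0,1,2}"
  shows "2/5 * v i + 3/5 * low v \<le> child_values i v j"
    and "child_values i v j \<le> 2/5 * v i + 3/5 * high v"
proof -
  have "2/5 * v i + 3/5 * low v \<le> child_values i v j \<and> child_values i v j \<le> 2/5 * v i + 3/5 * high v"
  proof (cases "i = j")
    case True
    then show ?thesis using low_le[OF i, of v] le_high[OF i, of v] by simp
  next
    case False
    then obtain k where ijk: "{i, j, k} = {0, 1, 2}" and k: "k \<in> {0,1,2}"
      using third_index[OF i j] by blast
    have "child_values i v j = 2/5 * v i + 2/5 * v j + 1/5 * v k"
      by (simp add: child_values_eq[OF ijk] add_divide_distrib)
    then show ?thesis
      using low_le[OF j, of v] le_high[OF j, of v] low_le[OF k, of v] le_high[OF k, of v]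
      by linarith
  qed
  then show "2/5 * v i + 3/5 * low v \<le> child_values i v j"
    "child_values i v j \<le> 2/5 * v i + 3/5 * high v" by auto
qed

lemma low_high_child_values:
  assumes i: "i \<in> {0,1,2}"
  shows "low v \<le> low (child_values i v)" "high (child_values i v) \<le> high v"
    and "high (child_values i v) - low (child_values i v) \<le> 3/5 * (high v - low v)"
proof -
  obtain j where j: "j \<in> {0,1,2}" "high (child_values i v) = child_values i v j"
    by (rule high_attained)
  obtain k where k: "k \<in> {0,1,2}" "low (child_values i v) = child_values i v k"
    by (rule low_attained)
  note bounds = child_values_bounds(2)[OF i j(1), of v] child_values_bounds(1)[OF i k(1), of v]
    low_le[OF i, of v] le_high[OF i, of v]
  show "low v \<le> low (child_values i v)" using bounds k(2) by linarith
  show "high (child_values i v) \<le> high v" using bounds j(2) by linarith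
  show "high (child_values i v) - low (child_values i v) \<le> 3/5 * (high v - low v)"
    using bounds j(2) k(2) by (simp add: right_diff_distrib)
qed

lemma cell_values_bounds:
  assumes "w \<in> lists {0,1,2}"
  shows "low v \<le> low (cell_values v w)" "high (cell_values v w) \<le> high v"
proof -
  have "low v \<le> low (cell_values v w) \<and> high (cell_values v w) \<le> high v"
    using assms
  proof (induction w arbitrary: v)
    case (Cons i w)
    show ?case
      using Cons.IH[of "child_values i v"] low_high_child_values(1,2)[OF Cons.hyps(1), of v] by simp
  qed simp
  then show "low v \<le> low (cell_values v w)" "high (cell_values v w) \<le> high v" by auto
qed

lemma cell_values_oscillation:
  assumes "w \<in> lists {0,1,2}"
  shows "high (cell_values v w) - low (cell_values v w) \<le> (3/5) ^ length w * (high v - low v)"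
  using assms
proof (induction w arbitrary: v)
  case (Cons i w)
  have "high (cell_values v (i # w)) - low (cell_values v (i # w))
    \<le> (3/5) ^ length w * (high (child_values i v) - low (child_values i v))"
    using Cons.IH by simp
  also have "\<dots> \<le> (3/5) ^ length w * (3/5 * (high v - low v))"
    by (intro mult_left_mono low_high_child_values(3) Cons.hyps) simp
  also have "\<dots> = (3/5) ^ length (i # w) * (high v - low v)"
    by (simp only: length_Cons power_Suc mult_ac)
  finally show ?case .
qed simp

lemma harmonic_on_cell_continuous: "harmonic_on_cell q w u \<Longrightarrow> continuous_on (cell q w) u"
  by (simp add: harmonic_on_cell_def)

lemma harmonic_on_cell_junction:
  assumes "harmonic_on_cell q w u" "w' \<in> lists {0,1,2}" "{i, j, k} = {0, 1, 2}"
  shows "u (sg_word q (w @ w' @ [i]) (q j)) = (2 * u (sg_word q (w @ w') (q i))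
    + 2 * u (sg_word q (w @ w') (q j)) + u (sg_word q (w @ w') (q k))) / 5"
  using conjunct2[OF assms(1)[unfolded harmonic_on_cell_def], rule_format, OF assms(2,3)] .

lemma harmonic_on_cell_values:
  assumes u: "harmonic_on_cell q w u" and "w' \<in> lists {0,1,2}" "j \<in> {0,1,2}"
  shows "u (sg_word q (w @ w') (q j)) = cell_values (\<lambda>j. u (sg_word q w (q j))) w' j"
  using assms(2,3)
proof (induction w' arbitrary: j rule: rev_induct)
  case (snoc i w')
  have w': "w' \<in> lists {0,1,2}" and i: "i \<in> {0,1,2}" using snoc.prems by auto
  let ?v = "cell_values (\<lambda>j. u (sg_word q w (q j))) w'"
  have IH: "u (sg_word q (w @ w') (q m)) = ?v m" if "m \<in> {0,1,2}" for m
    using snoc.IH[OF w' that] .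
  have "u (sg_word q (w @ w' @ [i]) (q j)) = child_values i ?v j"
  proof (cases "i = j")
    case True
    then show ?thesis using IH[OF i] by (simp add: sg_word_append)
  next
    case False
    then obtain k where ijk: "{i, j, k} = {0, 1, 2}" and k: "k \<in> {0,1,2}"
      using third_index[OF i snoc.prems(2)] by blast
    then show ?thesis
      by (simp only: harmonic_on_cell_junction[OF u w' ijk] IH[OF i] IH[OF snoc.prems(2)] IH[OF k]
          child_values_eq[OF ijk])
  qed
  then show ?case by (simp add: cell_values_append)
qed simp

text \<open>
  The algorithm takes convex combinations only, so the bounds at the vertices hold on a dense set of the
  cell and by continuity on the whole cell.
\<close>
lemma harmonic_maximum_principle:
  assumes u: "harmonic_on_cell q w u"
    and bd: "\<And>j. j \<in> {0,1,2} \<Longrightarrow> l \<le> u (sg_word q w (q j)) \<and> u (sg_word q w (q j)) \<le> h"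
    and x: "x \<in> cell q w"
  shows "l \<le> u x \<and> u x \<le> h"
proof -
  define v where "v = (\<lambda>j. u (sg_word q w (q j)))"
  have "l \<le> low v" "high v \<le> h"
    using bd by (auto simp: v_def low_def high_def)
  moreover have "u (sg_word q (w @ w') (q 0)) \<in> {low v..high v}" if w': "w' \<in> lists {0,1,2}" for w'
    using harmonic_on_cell_values[OF u w', of 0] cell_values_bounds[OF w', of v]
      low_le[of 0 "cell_values v w'"] le_high[of 0 "cell_values v w'"]
    unfolding v_def by auto
  moreover note harmonic_on_cell_continuous[OF u]
  ultimately have "u x \<in> {low v..high v}" "{low v..high v} \<subseteq> {l..h}"
    using cell_subset_of_closed[OF _ closed_real_atLeastAtMost _ x] by auto
  then have "u x \<in> {l..h}" by blast
  then show ?thesis by simp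
qed

lemma harmonic_on_cell_unique:
  assumes u: "harmonic_on_cell q w u" and v: "harmonic_on_cell q w v"
    and eq: "\<And>j. j \<in> {0,1,2} \<Longrightarrow> u (sg_word q w (q j)) = v (sg_word q w (q j))"
    and x: "x \<in> cell q w"
  shows "u x = v x"
proof -
  have diff: "harmonic_on_cell q w (\<lambda>x. u x - v x)"
    unfolding harmonic_on_cell_def
  proof (intro conjI ballI allI impI)
    show "continuous_on (cell q w) (\<lambda>x. u x - v x)"
      by (intro continuous_on_diff harmonic_on_cell_continuous u v)
    fix w' i j k assume w': "w' \<in> lists {0,1,2::nat}" and ijk: "{i, j, k} = {0, 1, 2::nat}"
    show "u (sg_word q (w @ w' @ [i]) (q j)) - v (sg_word q (w @ w' @ [i]) (q j)) =
        (2 * (u (sg_word q (w @ w') (q i)) - v (sg_word q (w @ w') (q i)))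
        + 2 * (u (sg_word q (w @ w') (q j)) - v (sg_word q (w @ w') (q j)))
        + (u (sg_word q (w @ w') (q k)) - v (sg_word q (w @ w') (q k)))) / 5"
      by (simp add: harmonic_on_cell_junction[OF u w' ijk] harmonic_on_cell_junction[OF v w' ijk]
          field_simps)
  qed
  have "0 \<le> u x - v x \<and> u x - v x \<le> 0"
    by (rule harmonic_maximum_principle[OF diff _ x]) (simp add: eq)
  then show ?thesis by simp
qed

lemma geometric_oscillation_small:
  assumes "e > 0"
  obtains n where "(3/5) ^ n * (high v - low v) < e"
proof -
  have "(\<lambda>n. (3/5) ^ n * (high v - low v)) \<longlonglongrightarrow> 0"
    by (intro tendsto_mult_left_zero LIMSEQ_power_zero) simp
  then show ?thesis
    using assms that by (metis eventually_happens' order_tendstoD(2) sequentially_bot)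
qed

context equilateral_triangle
begin

text \<open>
  A subcell that contains \<open>q\<^sub>j\<close> has a word consisting of \<open>j\<close> only, and the algorithm keeps the
  value at a shared vertex.
\<close>
lemma cell_values_at_vertex:
  assumes "w \<in> lists {0,1,2}" "j \<in> {0,1,2}" "q j \<in> cell q w"
  shows "cell_values v w j = v j"
  using assms(1,3)
proof (induction w arbitrary: v)
  case (Cons i w)
  then obtain z where z: "z \<in> cell q w" "sg_map q i z = q j"
    by (auto simp: cell_Cons)
  have "z \<in> SG q" using cell_subset_SG[OF Cons.hyps(2)] z by blast
  then have "i = j" "z = q j" using sg_map_eq_vertex[OF _ Cons.hyps(1) assms(2) z(2)] by auto
  then show ?case using Cons.IH[of "child_values i v"] z by simp
qed simp

text \<open>
  If one word is a prefix of the other, then the cells are nested and so are the ranges. At the first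
  letter where the words differ, the cells meet in one junction point, to which the
  algorithm assigns the same value from both sides; this value lies in both ranges.
\<close>
lemma cell_values_overlap:
  assumes "w \<in> lists {0,1,2}" "w' \<in> lists {0,1,2}" "x \<in> cell q w" "x \<in> cell q w'"
  shows "low (cell_values v w) \<le> high (cell_values v w')"
  using assms
proof (induction w arbitrary: w' v x)
  case Nil
  have "low v \<le> low (cell_values v w')" by (rule cell_values_bounds) (rule Nil)
  also have "\<dots> \<le> high (cell_values v w')" by (simp add: low_def high_def)
  finally show ?case by simp
next
  case (Cons i w)
  show ?case
  proof (cases w')
    case Nil
    have "low (cell_values v (i # w)) \<le> high (cell_values v (i # w))" by (simp add: low_def high_def)
    also have "\<dots> \<le> high v" by (rule cell_values_bounds) (use Cons in auto)
    finally show ?thesis using Nil by simp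
  next
    case w': (Cons j r)
    have j: "j \<in> {0,1,2}" and r: "r \<in> lists {0,1,2}" using Cons.prems w' by auto
    obtain y where y: "y \<in> cell q w" "x = sg_map q i y" using Cons.prems by (auto simp: cell_Cons)
    obtain z where z: "z \<in> cell q r" "x = sg_map q j z" using Cons.prems w' by (auto simp: cell_Cons)
    show ?thesis
    proof (cases "i = j")
      case True
      then have "y = z" using y z by simp
      then show ?thesis using Cons.IH[OF r, of y "child_values i v"] y z True w' by simp
    next
      case False
      have "y \<in> SG q" "z \<in> SG q"
        using y z cell_subset_SG[OF Cons.hyps(2)] cell_subset_SG[OF r] by auto
      then have "y = q j" "z = q i"
        using level1_intersection[of y z i j] y z False j Cons.hyps(1) by auto
      then have "cell_values (child_values i v) w j = child_values i v j"
        and "cell_values (child_values j v) r i = child_values j v i"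
        using cell_values_at_vertex y z Cons.hyps j r by auto
      moreover have "low (cell_values (child_values i v) w) \<le> cell_values (child_values i v) w j"
        using j by (rule low_le)
      moreover have "cell_values (child_values j v) r i \<le> high (cell_values (child_values j v) r)"
        using Cons.hyps(1) by (rule le_high)
      ultimately show ?thesis using w' child_values_commute[of i v j] by simp
    qed
  qed
qed

text \<open>
  The common number of the ranges of all subcells that contain \<open>x\<close>. Taking the infimum of their upper ends
  makes the definition independent of the choice of a word for \<open>x\<close>; junction points have several.
\<close>
definition harmonic_extension :: "(nat \<Rightarrow> real) \<Rightarrow> real^2 \<Rightarrow> real" where
  "harmonic_extension v x = Inf {high (cell_values v w) |w. w \<in> lists {0,1,2} \<and> x \<in> cell q w}"

lemma harmonic_extension_bounds:
  assumes "w \<in> lists {0,1,2}" "x \<in> cell q w"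
  shows "low (cell_values v w) \<le> harmonic_extension v x"
    and "harmonic_extension v x \<le> high (cell_values v w)"
proof -
  let ?H = "{high (cell_values v w) |w. w \<in> lists {0,1,2} \<and> x \<in> cell q w}"
  have low: "low (cell_values v w) \<le> h" if "h \<in> ?H" for h
    using that cell_values_overlap[OF assms(1) _ assms(2)] by blast
  have mem: "high (cell_values v w) \<in> ?H" using assms by blast
  show "low (cell_values v w) \<le> harmonic_extension v x"
    unfolding harmonic_extension_def using mem low by (intro cInf_greatest) auto
  show "harmonic_extension v x \<le> high (cell_values v w)"
    unfolding harmonic_extension_def using mem low by (intro cInf_lower bdd_belowI) auto
qed

lemma harmonic_extension_oscillation:
  assumes w: "w \<in> lists {0,1,2}" and "x \<in> cell q w" "y \<in> cell q w"
  shows "\<bar>harmonic_extension v x - harmonic_extension v y\<bar> \<le> (3/5) ^ length w * (high v - low v)"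
  using harmonic_extension_bounds[OF w assms(2), of v] harmonic_extension_bounds[OF w assms(3), of v]
    cell_values_oscillation[OF w, of v] by linarith

text \<open>
  The vertex lies in arbitrarily small subcells that keep it as their \<open>j\<close>-th vertex. All of their
  ranges contain both numbers.
\<close>
lemma harmonic_extension_boundary:
  assumes w: "w \<in> lists {0,1,2}" and j: "j \<in> {0,1,2}"
  shows "harmonic_extension v (sg_word q w (q j)) = cell_values v w j"
proof (rule ccontr)
  let ?d = "\<bar>harmonic_extension v (sg_word q w (q j)) - cell_values v w j\<bar>"
  assume "\<not> ?thesis"
  then have "?d > 0" by simp
  then obtain n where n: "(3/5) ^ n * (high (cell_values v w) - low (cell_values v w)) < ?d"
    by (rule geometric_oscillation_small)
  define r where "r = w @ replicate n j"
  have r: "r \<in> lists {0,1,2}" using w j by (auto simp: r_def in_lists_conv_set)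
  have "sg_word q w (q j) = sg_word q r (q j)" by (simp add: r_def sg_word_append)
  then have "sg_word q w (q j) \<in> cell q r"
    using vertex_in_SG[OF j] unfolding cell_def by auto
  note bounds = harmonic_extension_bounds[OF r this, of v]
  have val: "cell_values v r j = cell_values v w j"
    by (simp add: r_def cell_values_append cell_values_replicate_fixed)
  have "high (cell_values v r) - low (cell_values v r)
    \<le> (3/5) ^ n * (high (cell_values v w) - low (cell_values v w))"
    using cell_values_oscillation[of "replicate n j" "cell_values v w"] j
    by (auto simp: r_def cell_values_append in_lists_conv_set)
  then show False
    using n bounds low_le[OF j, of "cell_values v r"] le_high[OF j, of "cell_values v r"] val
    by linarith
qed

text \<open>
  Only finitely many cells of level \<open>n\<close> exist, so those that avoid \<open>x\<close> form a closed set. Near \<open>x\<close>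
  every point of the gasket therefore shares a cell of level \<open>n\<close> with \<open>x\<close>, and on such a cell the oscillation is small.
\<close>
lemma continuous_on_harmonic_extension: "continuous_on (SG q) (harmonic_extension v)"
  unfolding continuous_on_iff dist_real_def
proof (intro ballI allI impI)
  fix x and e :: real
  assume x: "x \<in> SG q" and "e > 0"
  then obtain n where n: "(3/5) ^ n * (high v - low v) < e"
    using geometric_oscillation_small by blast
  define W where "W = {w. set w \<subseteq> {0,1,2::nat} \<and> length w = n}"
  define F where "F = (\<Union>w\<in>{w \<in> W. x \<notin> cell q w}. cell q w)"
  have "finite W" unfolding W_def by (rule finite_lists_length_eq) simp
  then have "closed F"
    unfolding F_def by (intro closed_UN) (auto intro: compact_imp_closed[OF compact_cell])
  moreover have "x \<in> - F" by (auto simp: F_def)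
  ultimately obtain d where "d > 0" and d: "\<And>y. dist y x < d \<Longrightarrow> y \<notin> F"
    unfolding closed_def open_dist by blast
  have "\<bar>harmonic_extension v y - harmonic_extension v x\<bar> < e" if y: "y \<in> SG q" "dist y x < d" for y
  proof -
    obtain w where w: "w \<in> lists {0,1,2}" "length w = n" "y \<in> cell q w"
      using cell_cover[OF y(1)] by blast
    then have "x \<in> cell q w"
      using d[OF y(2)] by (auto simp: F_def W_def in_lists_conv_set)
    then show ?thesis
      using harmonic_extension_oscillation[OF w(1,3), of x v] n w(2) by simp
  qed
  then show "\<exists>d>0. \<forall>y\<in>SG q. dist y x < d
      \<longrightarrow> \<bar>harmonic_extension v y - harmonic_extension v x\<bar> < e"
    using \<open>d > 0\<close> by blast
qed

text \<open>
  Cells are similar to the gasket, and the algorithm does not see the similarity; the extension on the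
  gasket is carried over.
\<close>
lemma harmonic_on_cell_exists:
  obtains u where "harmonic_on_cell q w u" "\<And>j. j \<in> {0,1,2} \<Longrightarrow> u (sg_word q w (q j)) = v j"
proof -
  define u where "u = (\<lambda>x. harmonic_extension v (inv (sg_word q w) x))"
  have "inj (sg_word q w)" by (simp add: inj_def)
  then have inv: "inv (sg_word q w) (sg_word q w x) = x" for x by simp
  have val: "u (sg_word q (w @ w') (q j)) = cell_values v w' j"
    if "w' \<in> lists {0,1,2}" "j \<in> {0,1,2}" for w' j
    using that by (simp add: u_def sg_word_append inv harmonic_extension_boundary)
  have "continuous_on (cell q w) (inv (sg_word q w))"
    unfolding cell_def
    by (rule continuous_on_inv[OF continuous_on_sg_word compact_SG]) (simp add: inv)
  moreover have "inv (sg_word q w) ` cell q w \<subseteq> SG q" by (auto simp: cell_def inv)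
  ultimately have "continuous_on (cell q w) u"
    unfolding u_def by (rule continuous_on_compose2[OF continuous_on_harmonic_extension])
  moreover have "u (sg_word q (w @ w' @ [i]) (q j)) = (2 * u (sg_word q (w @ w') (q i))
      + 2 * u (sg_word q (w @ w') (q j)) + u (sg_word q (w @ w') (q k))) / 5"
    if w': "w' \<in> lists {0,1,2}" and ijk: "{i, j, k} = {0, 1, 2}" for w' i j k
  proof -
    have "i \<in> {0,1,2}" "j \<in> {0,1,2}" "k \<in> {0,1,2}" using ijk by blast+
    then show ?thesis
      using w' by (simp only: val append_in_lists_conv lists.Cons lists.Nil cell_values_append
          cell_values_Cons cell_values_Nil child_values_eq[OF ijk])
  qed
  ultimately have "harmonic_on_cell q w u"
    unfolding harmonic_on_cell_def by (intro conjI ballI allI impI)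
  moreover have "u (sg_word q w (q j)) = v j" if "j \<in> {0,1,2}" for j
    using val[of "[]" j] that by simp
  ultimately show ?thesis by (rule that)
qed

end

section \<open>The recurrence along the nodes\<close>

definition geometric_tail :: "(nat \<Rightarrow> real) \<Rightarrow> nat \<Rightarrow> real" where
  "geometric_tail a m = (\<Sum>k. 1 / 3 ^ (k + 1) * a (m + (k + 1)))"

lemma summable_geometric_tail:
  fixes a :: "nat \<Rightarrow> real"
  assumes "Bseq a"
  shows "summable (\<lambda>k. 1 / 3 ^ (k + 1) * a (m + (k + 1)))"
proof -
  from assms obtain K where K: "\<And>n. norm (a n) \<le> K" and "K > 0"
    by (auto simp: Bseq_def)
  have "summable (\<lambda>k. K * (1/3::real) ^ (k + 1))"
    by (intro summable_mult summable_ignore_initial_segment summable_geometric) simp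
  then show ?thesis
  proof (rule summable_comparison_test')
    fix n :: nat assume "n \<ge> 0"
    show "norm (1 / 3 ^ (n + 1) * a (m + (n + 1))) \<le> K * (1/3) ^ (n + 1)"
      using K[of "m + (n + 1)"] by (simp add: abs_mult field_simps)
  qed
qed

text \<open>
  The tails are a particular solution of an equation with the growing multiplier 3; summing over the
  future is what selects its bounded solution.
\<close>
lemma geometric_tail_Suc:
  assumes "Bseq a"
  shows "geometric_tail a (Suc m) = 3 * geometric_tail a m - a (Suc m)"
proof -
  let ?f = "\<lambda>k. 1 / 3 ^ (k + 1) * a (m + (k + 1))"
  have "(\<Sum>k. ?f (Suc k)) = suminf ?f - ?f 0"
    by (rule suminf_split_head) (rule summable_geometric_tail[OF assms])
  moreover have "(\<Sum>k. ?f (Suc k)) = (\<Sum>k. 1 / 3 * (1 / 3 ^ (k + 1) * a (Suc m + (k + 1))))"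
    by (simp add: field_simps)
  moreover have "\<dots> = 1 / 3 * geometric_tail a (Suc m)"
    unfolding geometric_tail_def by (rule suminf_mult[OF summable_geometric_tail[OF assms]])
  ultimately show ?thesis
    by (simp add: geometric_tail_def)
qed

lemma geometric_tail_tendsto:
  assumes "a \<longlonglongrightarrow> A"
  shows "geometric_tail a \<longlonglongrightarrow> A / 2"
proof -
  have B: "Bseq a" using assms convergent_def convergent_imp_Bseq by blast
  have "(\<lambda>k. (1 / 3::real) * (1 / 3) ^ k) sums (1 / 3 * (1 / (1 - 1 / 3)))"
    by (intro sums_mult geometric_sums) simp
  then have geo: "(\<lambda>k. 1 / 3 ^ (k + 1) :: real) sums (1 / 2)"
    by (simp add: power_one_over field_simps)
  have "\<exists>N. \<forall>m\<ge>N. \<bar>geometric_tail a m - A / 2\<bar> < e" if "e > 0" for e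
  proof -
    obtain N where N: "\<And>n. n \<ge> N \<Longrightarrow> \<bar>a n - A\<bar> < e"
      using assms \<open>e > 0\<close> unfolding LIMSEQ_def dist_real_def by blast
    have "\<bar>geometric_tail a m - A / 2\<bar> < e" if m: "m \<ge> N" for m
    proof -
      have "(\<lambda>k. 1 / 3 ^ (k + 1) * a (m + (k + 1))) sums geometric_tail a m"
        unfolding geometric_tail_def by (rule summable_sums[OF summable_geometric_tail[OF B]])
      from sums_diff[OF this sums_mult2[OF geo, of A]]
      have s: "(\<lambda>k. 1 / 3 ^ (k + 1) * (a (m + (k + 1)) - A)) sums (geometric_tail a m - A / 2)"
        by (simp add: right_diff_distrib)
      have le: "\<bar>1 / 3 ^ (k + 1) * (a (m + (k + 1)) - A)\<bar> \<le> 1 / 3 ^ (k + 1) * e" for k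
        unfolding abs_mult using N[of "m + (k + 1)"] m by (intro mult_mono) auto
      have "geometric_tail a m - A / 2 \<le> 1 / 2 * e"
        by (rule sums_le[OF _ s sums_mult2[OF geo]]) (use le abs_le_D1 in blast)
      moreover have "- (geometric_tail a m - A / 2) \<le> 1 / 2 * e"
        by (rule sums_le[OF _ sums_minus[OF s] sums_mult2[OF geo]]) (use le abs_le_D2 in blast)
      ultimately show ?thesis using \<open>e > 0\<close> by linarith
    qed
    then show ?thesis by blast
  qed
  then show ?thesis unfolding LIMSEQ_def dist_real_def by blast
qed

lemma contracting_recurrence_tendsto_0:
  fixes D b :: "nat \<Rightarrow> real"
  assumes rec: "\<And>n. D (Suc n) = r * D n + b n" and r: "0 \<le> r" "r < 1" and b: "b \<longlonglongrightarrow> 0"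
  shows "D \<longlonglongrightarrow> 0"
proof -
  have "\<exists>N. \<forall>n\<ge>N. \<bar>D n\<bar> < e" if e: "e > 0" for e
  proof -
      \<comment> \<open>With this bound on \<open>b\<close> the level \<open>e / 2\<close> is a fixed point of the recursive estimate.\<close>
  define d where "d = e * (1 - r) / 2"
    have "d > 0" using e r by (simp add: d_def)
    then obtain N where N: "\<And>n. n \<ge> N \<Longrightarrow> \<bar>b n\<bar> < d"
      using b unfolding LIMSEQ_def dist_real_def by (metis diff_0_right)
    have dr: "r * (e / 2) + d = e / 2"
      by (simp add: d_def field_simps)
    have bound: "\<bar>D (N + n)\<bar> \<le> r ^ n * \<bar>D N\<bar> + e / 2" for n
    proof (induction n)
      case 0 then show ?case using e by simp
    next
      case (Suc n)
      have "\<bar>D (N + Suc n)\<bar> \<le> r * \<bar>D (N + n)\<bar> + \<bar>b (N + n)\<bar>"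
        using rec[of "N + n"] r by (metis abs_mult abs_of_nonneg abs_triangle_ineq add_Suc_right)
      also have "\<dots> \<le> r * (r ^ n * \<bar>D N\<bar> + e / 2) + d"
        using Suc N[of "N + n"] r by (intro add_mono mult_left_mono) auto
      also have "\<dots> = r ^ Suc n * \<bar>D N\<bar> + e / 2"
        using dr by (simp add: algebra_simps)
      finally show ?case .
    qed
    have "(\<lambda>n. r ^ n * \<bar>D N\<bar>) \<longlonglongrightarrow> 0"
      using r by (intro tendsto_mult_left_zero LIMSEQ_power_zero) simp
    then obtain M where M: "\<And>n. n \<ge> M \<Longrightarrow> \<bar>r ^ n * \<bar>D N\<bar>\<bar> < e / 2"
      using e unfolding LIMSEQ_def dist_real_def by (metis diff_0_right half_gt_zero)
    have "\<bar>D n\<bar> < e" if "n \<ge> N + M" for n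
    proof -
      have "M \<le> n - N" "N + (n - N) = n" using that by auto
      then have "\<bar>D n\<bar> \<le> r ^ (n - N) * \<bar>D N\<bar> + e / 2" "\<bar>r ^ (n - N) * \<bar>D N\<bar>\<bar> < e / 2"
        using bound[of "n - N"] M[of "n - N"] by auto
      then show ?thesis by linarith
    qed
    then show ?thesis by blast
  qed
  then show ?thesis unfolding LIMSEQ_def dist_real_def by simp
qed

text \<open>
  The closed form of \<open>u(y\<^sub>m)\<close> for \<open>m \<ge> 2\<close>. It also gives the right values for \<open>m = 0\<close> and \<open>m = 1\<close>, which
  saves case distinctions at the start of the recurrence.
\<close>
definition node_value :: "(nat \<Rightarrow> real) \<Rightarrow> nat \<Rightarrow> real" where
  "node_value a m = 1 / 5 ^ m * (a 0 - 9/7 * geometric_tail a 0 + 2/7 * (\<Sum>k=1..m. 5 ^ k * a k))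
     + 9/7 * geometric_tail a m"

lemma node_value_0: "node_value a 0 = a 0"
  by (simp add: node_value_def)

lemma node_value_1:
  assumes "Bseq a"
  shows "node_value a 1 = 1/5 * (a 0 + a 1 + 18 * (\<Sum>k. 1 / 3 ^ (k + 2) * a (k + 2)))"
proof -
  have "(\<Sum>k. 1 / 3 ^ (k + 2) * a (k + 2)) = (\<Sum>k. 1 / 3 * (1 / 3 ^ (k + 1) * a (1 + (k + 1))))"
    by (simp add: field_simps)
  also have "\<dots> = 1 / 3 * geometric_tail a 1"
    unfolding geometric_tail_def by (rule suminf_mult[OF summable_geometric_tail[OF assms]])
  finally show ?thesis
    using geometric_tail_Suc[OF assms, of 0] by (simp add: node_value_def field_simps)
qed

lemma node_value_recurrence:
  assumes "Bseq a" "m \<ge> 1"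
  shows "16 * node_value a m
    = 3 * node_value a (m - 1) + 5 * node_value a (m + 1) + 3 * a m + 5 * a (m + 1)"
proof -
  from \<open>m \<ge> 1\<close> obtain n where m: "m = Suc n" by (cases m) auto
  show ?thesis
    by (simp add: m node_value_def geometric_tail_Suc[OF \<open>Bseq a\<close>] field_simps)
qed

text \<open>
  The average of the past data tends to \<open>5/14 A\<close> and the average of the future data to \<open>9/14 A\<close>.
\<close>
lemma node_value_tendsto:
  assumes a: "a \<longlonglongrightarrow> A"
  shows "node_value a \<longlonglongrightarrow> A"
proof -
  define c where "c = a 0 - 9/7 * geometric_tail a 0"
  define D where "D m = 1 / 5 ^ m * (c + 2/7 * (\<Sum>k=1..m. 5 ^ k * a k)) - 5/14 * A" for m
  have "D \<longlonglongrightarrow> 0"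
  proof (rule contracting_recurrence_tendsto_0)
    show "D (Suc n) = 1/5 * D n + 2/7 * (a (Suc n) - A)" for n
      by (simp add: D_def field_simps)
    have "(\<lambda>n. a (Suc n)) \<longlonglongrightarrow> A" using a by (rule LIMSEQ_Suc)
    from tendsto_mult[OF tendsto_const tendsto_diff[OF this tendsto_const], of "2/7" A]
    show "(\<lambda>n. 2/7 * (a (Suc n) - A)) \<longlonglongrightarrow> 0" by simp
  qed simp_all
  then have "(\<lambda>m. D m + 5/14 * A + 9/7 * geometric_tail a m) \<longlonglongrightarrow> 0 + 5/14 * A + 9/7 * (A / 2)"
    by (intro tendsto_intros geometric_tail_tendsto a)
  then show ?thesis
    by (simp add: D_def c_def node_value_def[abs_def])
qed

text \<open>
  The combination \<open>5 d\<^sub>m\<^sub>+\<^sub>1 - d\<^sub>m\<close> removes the decaying solution \<open>5\<^sup>-\<^sup>m\<close> and is multiplied by 3 in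
  each step. Boundedness makes it vanish, after which \<open>d\<close> is a multiple of \<open>5\<^sup>-\<^sup>m\<close> with initial value 0.
\<close>
lemma bounded_growing_recurrence_eq_0:
  fixes d :: "nat \<Rightarrow> real"
  assumes "Bseq d" and d0: "d 0 = 0"
    and rec: "\<And>m. m \<ge> 1 \<Longrightarrow> 16 * d m = 3 * d (m - 1) + 5 * d (m + 1)"
  shows "d m = 0"
proof -
  have growth: "5 * d (Suc m) - d m = 3 ^ m * (5 * d 1)" for m
  proof (induction m)
    case 0 then show ?case using d0 by simp
  next
    case (Suc m) then show ?case using rec[of "Suc m"] by simp
  qed
  obtain K where K: "\<And>n. \<bar>d n\<bar> \<le> K" using \<open>Bseq d\<close> by (auto simp: Bseq_def)
  have "d 1 = 0"
  proof (rule ccontr)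
    assume "d 1 \<noteq> 0"
    then obtain n where n: "6 * K / \<bar>5 * d 1\<bar> < 3 ^ n"
      using real_arch_pow[of 3 "6 * K / \<bar>5 * d 1\<bar>"] by auto
    have "3 ^ n * \<bar>5 * d 1\<bar> = \<bar>5 * d (Suc n) - d n\<bar>"
      by (simp add: growth abs_mult)
    also have "\<dots> \<le> 6 * K" using K[of n] K[of "Suc n"] by linarith
    finally show False using n \<open>d 1 \<noteq> 0\<close> by (simp add: field_simps)
  qed
  then have step: "d (Suc m) = d m / 5" for m using growth[of m] by simp
  show ?thesis by (induction m) (simp_all add: d0 step)
qed

section \<open>The half gasket\<close>

lemma harmonic_on_cell_cong:
  assumes h: "harmonic_on_cell q w h" and eq: "\<And>x. x \<in> cell q w \<Longrightarrow> u x = h x"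
  shows "harmonic_on_cell q w u"
  unfolding harmonic_on_cell_def
proof (intro conjI ballI allI impI)
  show "continuous_on (cell q w) u"
    using harmonic_on_cell_continuous[OF h] eq by (simp cong: continuous_on_cong)
  fix w' i j k assume w': "w' \<in> lists {0,1,2::nat}" and ijk: "{i, j, k} = {0, 1, 2::nat}"
  have mem: "i \<in> {0,1,2}" "j \<in> {0,1,2}" "k \<in> {0,1,2}" using ijk by blast+
  have val: "u (sg_word q (w @ v) (q l)) = h (sg_word q (w @ v) (q l))"
    if "v \<in> lists {0,1,2}" "l \<in> {0,1,2}" for v l
    using eq sg_word_in_SG[OF vertex_in_SG[OF that(2)] that(1)]
    by (simp add: sg_word_append cell_def)
  have wi: "w' @ [i] \<in> lists {0,1,2}" using w' mem(1) by simp
  show "u (sg_word q (w @ w' @ [i]) (q j)) = (2 * u (sg_word q (w @ w') (q i))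
      + 2 * u (sg_word q (w @ w') (q j)) + u (sg_word q (w @ w') (q k))) / 5"
    unfolding val[OF wi mem(2)] val[OF w' mem(1)] val[OF w' mem(2)] val[OF w' mem(3)]
    by (rule harmonic_on_cell_junction[OF h w' ijk])
qed

lemma hg_y_0 [simp]: "hg_y q 0 = q 1"
  by (simp add: hg_y_def)

lemma hg_cell_vertices:
  assumes "m \<ge> 1"
  shows "sg_word q (hg_Y_word m) (q 0) = hg_y q m"
    and "sg_word q (hg_Y_word m) (q 1) = hg_y q (m - 1)"
    and "sg_word q (hg_Y_word m) (q 2) = hg_x q m"
proof -
  obtain n where m: "m = Suc n" using assms by (cases m) auto
  have "hg_y q m = sg_word q (replicate n 0 @ [0]) (q 1)"
    by (simp add: m hg_y_def replicate_append_same)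
  then show "sg_word q (hg_Y_word m) (q 0) = hg_y q m"
    by (simp add: m hg_Y_word_def sg_word_append sg_map_commute[of q 0])
  show "sg_word q (hg_Y_word m) (q 1) = hg_y q (m - 1)"
    by (simp add: m hg_Y_word_def hg_y_def sg_word_append del: One_nat_def)
  show "sg_word q (hg_Y_word m) (q 2) = hg_x q m"
    by (simp add: m hg_Y_word_def hg_x_def sg_word_append sg_map_commute[of q 2])
qed

lemma hg_y_in_cell: "hg_y q m \<in> cell q (hg_Y_word (Suc m))"
  using imageI[OF vertex_in_SG[of 1 q], of "sg_word q (hg_Y_word (Suc m))"]
    hg_cell_vertices(2)[of "Suc m" q] by (simp add: cell_def)

lemma hg_cell_subset_closure: "m \<ge> 1 \<Longrightarrow> cell q (hg_Y_word m) \<subseteq> hg_closure q"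
  by (auto simp: hg_closure_def)

lemma hg_y_in_closure: "hg_y q m \<in> hg_closure q"
  using hg_y_in_cell[of q m] hg_cell_subset_closure[of "Suc m" q] by auto

lemma hg_closure_cases:
  assumes "x \<in> hg_closure q"
  obtains "x = q 0" | m where "m \<ge> 1" "x \<in> cell q (hg_Y_word m)"
  using assms by (auto simp: hg_closure_def)

lemma hg_y_tendsto: "hg_y q \<longlonglongrightarrow> q 0"
proof -
  have "dist (hg_y q m) (q 0) = dist (q 1) (q 0) * (1/2) ^ m" for m
    using dist_sg_word[of q "replicate m 0" "q 1" "q 0"] by (simp add: hg_y_def power_one_over)
  then have "(\<lambda>m. dist (hg_y q m) (q 0)) \<longlonglongrightarrow> 0"
    by (simp add: tendsto_mult_right_zero LIMSEQ_power_zero)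
  then show ?thesis by (rule iffD2[OF tendsto_dist_iff])
qed

lemma flux_matching_iff:
  fixes y y' y'' b c :: real
  shows "(5/3) ^ m * (2 * y - y' - b) + (5/3) ^ (m + 1) * (2 * y - y'' - c) = 0
    \<longleftrightarrow> 16 * y = 3 * y' + 5 * y'' + 3 * b + 5 * c"
proof -
  have eq: "(5/3) ^ m * (2 * y - y' - b) + (5/3) ^ (m + 1) * (2 * y - y'' - c)
    = (5/3) ^ m * ((16 * y - (3 * y' + 5 * y'' + 3 * b + 5 * c)) / 3)"
    by (simp add: field_simps)
  show ?thesis unfolding eq by simp
qed

context equilateral_triangle
begin

lemma vertices_distinct: "q 1 \<noteq> q 0"
  using equilateral unfolding equilateral_def by metis

lemma hg_y_neq: "hg_y q m \<noteq> q 0"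
  using sg_word_eq_iff[of q "replicate m 0" "q 1" "q 0"] vertices_distinct
  by (simp add: hg_y_def)

lemma hg_closure_limit_point: "at (q 0) within hg_closure q \<noteq> bot"
  unfolding trivial_limit_within islimpt_sequential
  using hg_y_tendsto[of q] hg_y_in_closure[of q] hg_y_neq by blast

lemma bary_replicate:
  "bary 0 (sg_word q (replicate n 0) x) = 1 - (1 - bary 0 x) / 2 ^ n"
  by (induction n) (simp_all add: bary_sg_map field_simps)

lemma bary_hg_cell:
  assumes "m \<ge> 1"
  shows "bary 0 (sg_word q (hg_Y_word m) z) = 1 - (2 - bary 0 z) / 2 ^ m"
proof -
  obtain n where m: "m = Suc n" using assms by (cases m) auto
  have "bary 0 (sg_map q 1 z) = bary 0 z / 2" by (simp add: bary_sg_map)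
  then show ?thesis
    by (simp add: m hg_Y_word_def sg_word_append bary_replicate del: One_nat_def)
      (simp add: field_simps)
qed

text \<open>
  The coordinate \<open>\<lambda>\<^sub>0\<close> orders the cells: they fill consecutive intervals that accumulate at 1. Both the
  separation of the cells and the neighbourhoods of \<open>q\<^sub>0\<close> are controlled through it.
\<close>
lemma bary_hg_cell_bounds:
  assumes "m \<ge> 1" "x \<in> cell q (hg_Y_word m)"
  shows "1 - 2 / 2 ^ m \<le> bary 0 x" "bary 0 x \<le> 1 - 1 / 2 ^ m"
proof -
  obtain z where z: "z \<in> SG q" "x = sg_word q (hg_Y_word m) z"
    using assms(2) by (auto simp: cell_def)
  have "0 \<le> bary 0 z" "bary 0 z \<le> 1" using bary_nonneg bary_le_1 z(1) by auto
  then show "1 - 2 / 2 ^ m \<le> bary 0 x" "bary 0 x \<le> 1 - 1 / 2 ^ m"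
    unfolding z(2) bary_hg_cell[OF assms(1)] by (simp_all add: divide_right_mono)
qed

lemma vertex_notin_hg_cell:
  assumes "m \<ge> 1"
  shows "q 0 \<notin> cell q (hg_Y_word m)"
proof
  assume "q 0 \<in> cell q (hg_Y_word m)"
  then have "1 \<le> 1 - 1 / (2::real) ^ m"
    using bary_hg_cell_bounds(2)[OF assms, of "q 0"] bary_vertex[of 0 0] by simp
  moreover have "0 < 1 / (2::real) ^ m" by simp
  ultimately show False by linarith
qed

text \<open>
  The intervals of \<open>\<lambda>\<^sub>0\<close> overlap only for consecutive cells, and then only in one endpoint. On the
  \<open>m\<close>-th cell this endpoint is attained at the vertex \<open>y\<^sub>m\<close> alone.
\<close>
lemma hg_cells_intersection:
  assumes "1 \<le> m" "m < n" and x: "x \<in> cell q (hg_Y_word m)" "x \<in> cell q (hg_Y_word n)"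
  shows "n = Suc m \<and> x = hg_y q m"
proof -
  have n: "1 \<le> n" using assms by simp
  obtain z where z: "z \<in> SG q" "x = sg_word q (hg_Y_word m) z"
    using x(1) by (auto simp: cell_def)
  have le1: "bary 0 z \<le> 1" by (rule bary_le_1[OF z(1)]) simp
  have "1 - 2 / 2 ^ n \<le> 1 - (2 - bary 0 z) / 2 ^ m"
    using bary_hg_cell_bounds(1)[OF n x(2)] bary_hg_cell[OF assms(1), of z] z(2) by simp
  then have le: "(2 - bary 0 z) * 2 ^ n \<le> 2 ^ Suc m" by (simp add: field_simps)
  have "1 * 2 ^ n \<le> (2 - bary 0 z) * 2 ^ n" using le1 by (intro mult_right_mono) auto
  from order_trans[OF this le] have "(2::real) ^ n \<le> 2 ^ Suc m" by (simp only: mult_1)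
  then have nm: "n = Suc m" using assms(2) by (simp del: power_Suc)
  have "(2 - bary 0 z) * 2 ^ n \<le> 1 * 2 ^ n" using le by (simp add: nm)
  then have "2 - bary 0 z \<le> 1" by (rule mult_right_le_imp_le) simp
  then have "z = q 0" using le1 by (intro bary_eq_1_imp_vertex z(1)) auto
  then show ?thesis using nm z(2) hg_cell_vertices(1)[OF assms(1)] by simp
qed

text \<open>
  Away from \<open>q\<^sub>0\<close> the cells form a locally finite closed cover, so continuity is inherited from the cells;
  at \<open>q\<^sub>0\<close>, where they accumulate, it has to be assumed.
\<close>
lemma continuous_on_hg_closure:
  assumes cont: "\<And>m. m \<ge> 1 \<Longrightarrow> continuous_on (cell q (hg_Y_word m)) u"
    and lim: "(u \<longlongrightarrow> u (q 0)) (at (q 0) within hg_closure q)"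
  shows "continuous_on (hg_closure q) u"
  unfolding continuous_on_def
proof
  fix x assume x: "x \<in> hg_closure q"
  then show "(u \<longlongrightarrow> u x) (at x within hg_closure q)"
  proof (cases rule: hg_closure_cases)
    case 1
    then show ?thesis using lim by simp
  next
    case (2 m)
    \<comment> \<open>The threshold lies strictly beyond the \<open>m\<close>-th cell, so that only the cells up to index \<open>m + 1\<close> meet \<open>U\<close>.\<close>
    define U where "U = {y. bary 0 y < 1 - 1 / 2 ^ Suc m}"
    define K where "K = (\<Union>n\<in>{1..Suc m}. cell q (hg_Y_word n))"
    have "open U"
      unfolding U_def by (intro open_Collect_less continuous_on_bary continuous_on_const)
    have "(1::real) / 2 ^ Suc m < 1 / 2 ^ m" by (simp add: field_simps)
    then have "x \<in> U" using bary_hg_cell_bounds(2)[OF 2] by (simp add: U_def)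
    have sub: "hg_closure q \<inter> U \<subseteq> K"
    proof
      fix y assume y: "y \<in> hg_closure q \<inter> U"
      then have "y \<in> hg_closure q" by blast
      then show "y \<in> K"
      proof (cases rule: hg_closure_cases)
        case 1
        then show ?thesis using y by (simp add: U_def bary_vertex)
      next
        case (2 n)
        have "1 - 2 / 2 ^ n < (1::real) - 1 / 2 ^ Suc m"
          using bary_hg_cell_bounds(1)[OF 2] y by (simp add: U_def)
        then have "(2::real) ^ n < 2 ^ Suc (Suc m)" by (simp add: field_simps)
        then have "n < Suc (Suc m)" by (rule power_less_imp_less_exp[rotated]) simp
        then show ?thesis using 2 by (auto simp: K_def)
      qed
    qed
    have "continuous_on K u"
      unfolding K_def
      by (intro continuous_on_closed_Union) (auto intro: cont compact_imp_closed[OF compact_cell])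
    moreover have "x \<in> K" using x \<open>x \<in> U\<close> sub by blast
    ultimately have "(u \<longlongrightarrow> u x) (at x within K)" by (simp add: continuous_on_def)
    then have "(u \<longlongrightarrow> u x) (at x within hg_closure q \<inter> U)"
      using sub by (rule tendsto_within_subset)
    moreover have "at x within hg_closure q = at x within hg_closure q \<inter> U"
      by (rule at_within_nhd[OF \<open>x \<in> U\<close> \<open>open U\<close>]) auto
    ultimately show ?thesis by simp
  qed
qed

text \<open>
  A neighbourhood of \<open>q\<^sub>0\<close> meets only cells with large index. There all three vertex values are close to \<open>A\<close>,
  and the maximum principle extends this to the cells.
\<close>
lemma harmonic_tendsto_at_vertex:
  assumes harm: "\<And>m. m \<ge> 1 \<Longrightarrow> harmonic_on_cell q (hg_Y_word m) u"
    and y: "(\<lambda>m. u (hg_y q m)) \<longlonglongrightarrow> A" and x: "(\<lambda>m. u (hg_x q m)) \<longlonglongrightarrow> A"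
  shows "(u \<longlongrightarrow> A) (at (q 0) within hg_closure q)"
proof (rule tendstoI)
  fix e :: real assume "e > 0"
  then have "e / 2 > 0" by simp
  from LIMSEQ_D[OF y this] LIMSEQ_D[OF x this] obtain N1 N2
    where N: "\<And>m. m \<ge> N1 \<Longrightarrow> norm (u (hg_y q m) - A) < e / 2"
      "\<And>m. m \<ge> N2 \<Longrightarrow> norm (u (hg_x q m) - A) < e / 2" by blast
  define N where "N = max N1 N2"
  define U where "U = {z. 1 - 1 / 2 ^ Suc N < bary 0 z}"
  have "open U"
    unfolding U_def by (intro open_Collect_less continuous_on_bary continuous_on_const)
  moreover have "q 0 \<in> U" by (simp add: U_def bary_vertex)
  moreover have "dist (u z) A < e" if z: "z \<in> U" "z \<noteq> q 0" "z \<in> hg_closure q" for z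
    using z(3)
  proof (cases rule: hg_closure_cases)
    case 1
    then show ?thesis using z by simp
  next
    case (2 n)
    have "(1::real) - 1 / 2 ^ Suc N < 1 - 1 / 2 ^ n"
      using bary_hg_cell_bounds(2)[OF 2] z(1) by (simp add: U_def)
    then have "(2::real) ^ Suc N < 2 ^ n" by (simp add: field_simps)
    then have "Suc N < n" by (rule power_less_imp_less_exp[rotated]) simp
    then have n: "n \<ge> N1" "n - 1 \<ge> N1" "n \<ge> N2" by (auto simp: N_def)
    have "A - e/2 \<le> u z \<and> u z \<le> A + e/2"
    proof (rule harmonic_maximum_principle[OF harm[OF 2(1)] _ 2(2)])
      fix j :: nat assume "j \<in> {0,1,2}"
      then consider "j = 0" | "j = 1" | "j = 2" by blast
      then show "A - e/2 \<le> u (sg_word q (hg_Y_word n) (q j))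
          \<and> u (sg_word q (hg_Y_word n) (q j)) \<le> A + e/2"
      proof cases
        case 1
        then show ?thesis using N(1)[OF n(1)] hg_cell_vertices(1)[OF 2(1), of q]
          by (simp add: abs_if split: if_splits)
      next
        case j: 2
        show ?thesis using N(1)[OF n(2)]
          unfolding j hg_cell_vertices(2)[OF 2(1), of q] by (simp add: abs_if split: if_splits)
      next
        case 3
        then show ?thesis using N(2)[OF n(3)] hg_cell_vertices(3)[OF 2(1), of q]
          by (simp add: abs_if split: if_splits)
      qed
    qed
    then show ?thesis using \<open>e > 0\<close> unfolding dist_real_def by (auto simp: abs_if)
  qed
  ultimately show "\<forall>\<^sub>F z in at (q 0) within hg_closure q. dist (u z) A < e"
    unfolding eventually_at_topological by blast
qed

lemma hg_explicit_extension_iff: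
  assumes "Bseq a"
  shows "hg_explicit_extension q a u \<longleftrightarrow>
    (\<forall>m\<ge>1. harmonic_on_cell q (hg_Y_word m) u) \<and>
    (\<forall>m. u (hg_y q m) = node_value a m) \<and> (\<forall>m\<ge>1. u (hg_x q m) = a m) \<and>
    u (q 0) = Lim (at (q 0) within hg_closure q) u"
proof -
  have split: "(\<forall>m. P m) \<longleftrightarrow> P 0 \<and> P 1 \<and> (\<forall>m\<ge>2. P m)" for P :: "nat \<Rightarrow> bool"
    by (metis One_nat_def Suc_1 less_2_cases not_less)
  have "(\<forall>m. u (hg_y q m) = node_value a m) \<longleftrightarrow> u (q 1) = a 0 \<and>
     u (hg_y q 1) = 1/5 * (a 0 + a 1 + 18 * (\<Sum>k. 1 / 3 ^ (k + 2) * a (k + 2))) \<and>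
     (\<forall>m\<ge>2. u (hg_y q m) = node_value a m)"
    by (subst split) (simp only: hg_y_0 node_value_0 node_value_1[OF assms])
  then show ?thesis
    unfolding hg_explicit_extension_def node_value_def geometric_tail_def add_0 by blast
qed

lemma hg_explicit_extension_tendsto:
  assumes u: "hg_explicit_extension q a u" and a: "a \<longlonglongrightarrow> A"
  shows "(u \<longlongrightarrow> u (q 0)) (at (q 0) within hg_closure q)"
proof -
  have "Bseq a" using a convergent_def convergent_imp_Bseq by blast
  note u' = u[unfolded hg_explicit_extension_iff[OF this]]
  have "\<forall>\<^sub>F m in sequentially. u (hg_x q m) = a m"
    using u' by (intro eventually_sequentiallyI[of 1]) blast
  then have "(\<lambda>m. u (hg_x q m)) \<longlonglongrightarrow> A" using a by (simp cong: tendsto_cong)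
  moreover have "(\<lambda>m. u (hg_y q m)) \<longlonglongrightarrow> A" using u' node_value_tendsto[OF a] by simp
  ultimately have lim: "(u \<longlongrightarrow> A) (at (q 0) within hg_closure q)"
    using u' by (intro harmonic_tendsto_at_vertex) auto
  then have "u (q 0) = A" using u' tendsto_Lim[OF hg_closure_limit_point lim] by simp
  then show ?thesis using lim by simp
qed

text \<open>
  The harmonic functions on the single cells are glued. Consecutive cells share one point, at which both
  have the same prescribed node value. The limit at \<open>q\<^sub>0\<close> does not involve the value there, so that
  this value can be set to \<open>A\<close> in advance.
\<close>
lemma hg_explicit_extension_exists:
  assumes a: "a \<longlonglongrightarrow> A"
  shows "\<exists>u. hg_explicit_extension q a u"
proof -
  have B: "Bseq a" using a convergent_def convergent_imp_Bseq by blast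
  define v where "v m j = (if j = 0 then node_value a m else if j = 1 then node_value a (m - 1) else a m)"
    for m j :: nat
  have "\<exists>h. harmonic_on_cell q (hg_Y_word m) h \<and>
      (\<forall>j\<in>{0,1,2}. h (sg_word q (hg_Y_word m) (q j)) = v m j)" for m
    using harmonic_on_cell_exists[of "hg_Y_word m" "v m"] by metis
  then obtain h where h: "\<And>m. harmonic_on_cell q (hg_Y_word m) (h m)"
    and hv: "\<And>m j. j \<in> {0,1,2} \<Longrightarrow> h m (sg_word q (hg_Y_word m) (q j)) = v m j"
    by metis
  have vals: "h m (hg_y q m) = node_value a m" "h m (hg_y q (m - 1)) = node_value a (m - 1)"
    "h m (hg_x q m) = a m" if "m \<ge> 1" for m
    using hv[of 0 m] hv[of 1 m] hv[of 2 m] unfolding hg_cell_vertices[OF that] v_def by simp_all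
  \<comment> \<open>A node lies in two cells; the smaller index is used there.\<close>
  define first where "first x = (LEAST m. m \<ge> 1 \<and> x \<in> cell q (hg_Y_word m))" for x
  define u where "u x = (if x = q 0 then A else h (first x) x)" for x
  have uh: "u x = h m x" if m: "m \<ge> 1" and x: "x \<in> cell q (hg_Y_word m)" for m x
  proof -
    have f: "first x \<ge> 1 \<and> x \<in> cell q (hg_Y_word (first x))" "first x \<le> m"
      unfolding first_def using m x by (auto intro: LeastI2 Least_le)
    have "h (first x) x = h m x"
    proof (cases "first x = m")
      case False
      then have "m = Suc (first x) \<and> x = hg_y q (first x)"
        using f x by (intro hg_cells_intersection) auto
      then show ?thesis using vals(1)[of "first x"] vals(2)[of m] f by simp
    qed simp
    moreover have "x \<noteq> q 0" using vertex_notin_hg_cell[OF m] x by blast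
    ultimately show ?thesis by (simp add: u_def)
  qed
  have harm: "harmonic_on_cell q (hg_Y_word m) u" if "m \<ge> 1" for m
    using h uh[OF that] by (rule harmonic_on_cell_cong)
  have uy: "u (hg_y q m) = node_value a m" for m
    using uh[OF _ hg_y_in_cell] vals(2)[of "Suc m"] by simp
  have ux: "u (hg_x q m) = a m" if "m \<ge> 1" for m
  proof -
    have "hg_x q m \<in> cell q (hg_Y_word m)"
      using imageI[OF vertex_in_SG[of 2 q], of "sg_word q (hg_Y_word m)"]
        hg_cell_vertices(3)[OF that, of q] by (simp add: cell_def)
    then show ?thesis using uh[OF that] vals(3)[OF that] by simp
  qed
  have "\<forall>\<^sub>F m in sequentially. u (hg_x q m) = a m"
    using ux by (intro eventually_sequentiallyI[of 1]) blast
  then have "(\<lambda>m. u (hg_x q m)) \<longlonglongrightarrow> A" using a by (simp cong: tendsto_cong)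
  moreover have "(\<lambda>m. u (hg_y q m)) \<longlonglongrightarrow> A" using uy node_value_tendsto[OF a] by simp
  ultimately have lim: "(u \<longlongrightarrow> A) (at (q 0) within hg_closure q)"
    using harm by (intro harmonic_tendsto_at_vertex) auto
  have "u (q 0) = A" by (simp add: u_def)
  then have "u (q 0) = Lim (at (q 0) within hg_closure q) u"
    using tendsto_Lim[OF hg_closure_limit_point lim] by simp
  then have "hg_explicit_extension q a u"
    unfolding hg_explicit_extension_iff[OF B] using harm uy ux by blast
  then show ?thesis by blast
qed

lemma hg_solves_bvp_iff:
  "hg_solves_bvp q a u \<longleftrightarrow>
    (\<forall>m\<ge>1. harmonic_on_cell q (hg_Y_word m) u) \<and>
    (\<forall>m\<ge>1. 16 * u (hg_y q m)
        = 3 * u (hg_y q (m - 1)) + 5 * u (hg_y q (m + 1)) + 3 * a m + 5 * a (m + 1)) \<and>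
    u (q 1) = a 0 \<and> (\<forall>m\<ge>1. u (hg_x q m) = a m)"
  unfolding hg_solves_bvp_def hg_laplace_zero_def flux_matching_iff by auto

lemma hg_explicit_extension_solves:
  assumes "Bseq a" "hg_explicit_extension q a u"
  shows "hg_solves_bvp q a u"
proof -
  note u = assms(2)[unfolded hg_explicit_extension_iff[OF assms(1)]]
  then have "u (q 1) = a 0" using hg_y_0 node_value_0 by metis
  then show ?thesis
    unfolding hg_solves_bvp_iff using u node_value_recurrence[OF assms(1)] by simp
qed

text \<open>
  Continuity at \<open>q\<^sub>0\<close> enters through \<open>y\<^sub>m \<rightarrow> q\<^sub>0\<close>: it bounds the difference of the two solutions at the
  nodes and thereby excludes the growth like \<open>3\<^sup>m\<close>.
\<close>
lemma continuous_solution_unique: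
  assumes u: "continuous_on (hg_closure q) u" "hg_solves_bvp q a u"
    and v: "continuous_on (hg_closure q) v" "hg_solves_bvp q a v"
    and x: "x \<in> hg_closure q"
  shows "v x = u x"
proof -
  note u' = u(2)[unfolded hg_solves_bvp_iff] and v' = v(2)[unfolded hg_solves_bvp_iff]
  have q0: "q 0 \<in> hg_closure q" by (simp add: hg_closure_def)
  have lim: "(\<lambda>m. f (hg_y q m)) \<longlonglongrightarrow> f (q 0)" if "continuous_on (hg_closure q) f" for f :: "real^2 \<Rightarrow> real"
    by (rule continuous_on_tendsto_compose[OF that hg_y_tendsto[of q] q0]) (simp add: hg_y_in_closure)
  define d where "d m = v (hg_y q m) - u (hg_y q m)" for m
  have "d \<longlonglongrightarrow> v (q 0) - u (q 0)"
    unfolding d_def by (intro tendsto_diff lim u v)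
  then have dB: "Bseq d" using convergent_def convergent_imp_Bseq by blast
  have d0: "d 0 = 0" using u' v' by (simp add: d_def)
  have rec: "16 * d m = 3 * d (m - 1) + 5 * d (m + 1)" if "m \<ge> 1" for m
  proof -
    have "16 * v (hg_y q m)
        = 3 * v (hg_y q (m - 1)) + 5 * v (hg_y q (m + 1)) + 3 * a m + 5 * a (m + 1)"
      "16 * u (hg_y q m)
        = 3 * u (hg_y q (m - 1)) + 5 * u (hg_y q (m + 1)) + 3 * a m + 5 * a (m + 1)"
      using u' v' that by blast+
    then show ?thesis unfolding d_def by (simp add: algebra_simps)
  qed
  have "d m = 0" for m by (rule bounded_growing_recurrence_eq_0[OF dB d0 rec])
  then have y: "v (hg_y q m) = u (hg_y q m)" for m by (simp add: d_def)
  show ?thesis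
    using x
  proof (cases rule: hg_closure_cases)
    case 1
    have "(\<lambda>m. v (hg_y q m)) \<longlonglongrightarrow> u (q 0)" using lim[OF u(1)] y by simp
    then show ?thesis using 1 LIMSEQ_unique[OF lim[OF v(1)]] by simp
  next
    case (2 m)
    have xm: "v (hg_x q m) = u (hg_x q m)" using u' v' 2(1) by simp
    have eq: "v (sg_word q (hg_Y_word m) (q j)) = u (sg_word q (hg_Y_word m) (q j))"
      if "j \<in> {0,1,2}" for j
      using that hg_cell_vertices[OF 2(1), of q] y xm by (elim insertE emptyE) simp_all
    have "harmonic_on_cell q (hg_Y_word m) v" "harmonic_on_cell q (hg_Y_word m) u"
      using u' v' 2(1) by blast+
    then show ?thesis using eq 2(2) by (rule harmonic_on_cell_unique)
  qed
qed

end

theorem corollary2p5: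
  fixes q :: "nat \<Rightarrow> real^2" and a :: "nat \<Rightarrow> real" and A :: real
  assumes "equilateral q"
    and "a \<longlonglongrightarrow> A"
  shows "(\<exists>u. hg_explicit_extension q a u) \<and>
         (\<forall>u. hg_explicit_extension q a u \<longrightarrow>
            hg_solves_bvp q a u \<and>
            continuous_on (hg_closure q) u \<and>
            (\<forall>v. continuous_on (hg_closure q) v \<and> hg_solves_bvp q a v \<longrightarrow>
               (\<forall>x\<in>hg_closure q. v x = u x)))"
proof -
  interpret equilateral_triangle q by standard (rule assms(1))
  have B: "Bseq a" using assms(2) convergent_def convergent_imp_Bseq by blast
  have "hg_solves_bvp q a u \<and> continuous_on (hg_closure q) u \<and>
      (\<forall>v. continuous_on (hg_closure q) v \<and> hg_solves_bvp q a v \<longrightarrow>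
         (\<forall>x\<in>hg_closure q. v x = u x))"
    if u: "hg_explicit_extension q a u" for u
  proof -
    have sol: "hg_solves_bvp q a u" by (rule hg_explicit_extension_solves[OF B u])
    have cont: "continuous_on (hg_closure q) u"
    proof (rule continuous_on_hg_closure)
      show "continuous_on (cell q (hg_Y_word m)) u" if "m \<ge> 1" for m
        using u that by (intro harmonic_on_cell_continuous) (simp add: hg_explicit_extension_def)
      show "(u \<longlongrightarrow> u (q 0)) (at (q 0) within hg_closure q)"
        by (rule hg_explicit_extension_tendsto[OF u assms(2)])
    qed
    show ?thesis using sol cont continuous_solution_unique[OF cont sol] by blast
  qed
  then show ?thesis using hg_explicit_extension_exists[OF assms(2)] by blast
qed

end
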